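(* Let $G$ be a simply-connected complex simple Lie group with base of simple roots $\Delta$, and let $P$ be a proper parabolic subgroup, $B\subsetneq P\subsetneq G$, such that the Dynkin diagram of $\Delta_P$ is connected and $\Delta_P$ is not of type $A$; let $\Delta_P=\{\alpha_1,\dots,\alpha_r\}$ be ordered as in the list in the context. Then the two grading maps $gr,gr':W\times Q^\vee\to\mathbb Z^{r+1}$ defined in the context coincide: $gr=gr'$.
   Context: Lie notation. $\Delta=\{\alpha_1,\dots,\alpha_n\}$ simple roots, $\alpha_i^\vee$ simple coroots, $Q^\vee=\bigoplus\mathbb Z\alpha_i^\vee$, $\langle\cdot,\cdot\rangle$ the pairing of roots with coroots, $R^+$ positive roots, $W$ Weyl group with length $\ell$, $\mathrm{Inv}(w)=\{\beta\in R^+:w(\beta)\in-R^+\}$. Parabolics $P'\supset B$ correspond to subsets $\Delta_{P'}\subset\Delta$, $P_{\Delta'}$ being attached to $\Delta'$; $W_{P'}$ is generated by $s_\alpha$, $\alpha\in\Delta_{P'}$, with longest element $w_{P'}$; $R^+_{P'}$ is the set of positive roots in the span of $\Delta_{P'}$; $Q^\vee_{P'}=\bigoplus_{\alpha\in\Delta_{P'}}\mathbb Z\alpha^\vee$; for $\Delta_{P''}\subset\Delta_{P'}$, $W^{P''}_{P'}\subset W_{P'}$ is the set of minimal length representatives of $W_{P'}/W_{P''}$. Put $\Delta_0=\emptyset$, $\Delta_j=\{\alpha_1,\dots,\alpha_j\}$ ($1\le j\le r$), $\Delta_{r+1}=\Delta$, $P_j=P_{\Delta_j}$; $\mathbf e_1,\dots,\mathbf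 e_{r+1}$ is the standard basis of $\mathbb Z^{r+1}$. Definition of $gr$: $$gr(w,\lambda)=\sum_{i=1}^{r+1}\Big(\big|\mathrm{Inv}(w)\cap(R^+_{P_i}\setminus R^+_{P_{i-1}})\big|+\sum_{\beta\in R^+_{P_i}\setminus R^+_{P_{i-1}}}\langle\beta,\lambda\rangle\Big)\mathbf e_i.$$ Definition of $gr'$: (1) For $w\in W$ with its unique decomposition $w=v_{r+1}\cdots v_1$, $v_j\in W^{P_{j-1}}_{P_j}$, set $gr'(w,0)=\sum_{i=1}^{r+1}\ell(v_i)\mathbf e_i$. (2) $gr'(\mathrm{id},\alpha_1^\vee)=2\mathbf e_1$; recursively, for $1\le j\le r$ and $\alpha\in\Delta_{j+1}\setminus\Delta_j$, let $\lambda=\alpha^\vee+\sum_{i=1}^ja_i\alpha_i^\vee$ be the unique element of $\alpha^\vee+Q^\vee_{P_j}$ with $\langle\gamma,\lambda\rangle\in\{0,-1\}$ for all $\gamma\in R^+_{P_j}$, let $\Delta_{P_j'}=\{\beta\in\Delta_j:\langle\beta,\lambda\rangle=0\}$, and set $$gr'(\mathrm{id},\alpha^\vee)=\Big(\ell(w_{P_j}w_{P_j'})+2+\sum_{i=1}^j2a_i\Big)\mathbf e_{j+1}-gr'(w_{P_j}w_{P_j'},0)-\sum_{i=1}^ja_i\,gr'(\mathrm{id},\alpha_i^\vee).$$ (3) $gr'(w,\sum_{k=1}^nb_k\alpha_k^\vee)=gr'(w,0)+\sum_{k=1}^nb_k\,gr'(\mathrm{id},\alpha_k^\vee)$. Ordering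 of $\Delta_P=\{\alpha_1,\dots,\alpha_r\}$ (edges simple unless said otherwise): (C1B) $\Delta$ of type $B_n$, chain $\alpha_1,\dots,\alpha_r$ of type $B_r$ ($r\ge2$), $\alpha_r$ short, $\alpha_{r+1}\notin\Delta_P$ adjacent to $\alpha_1$; (C1C) $\Delta$ of type $C_n$, chain $\alpha_1,\dots,\alpha_r$ of type $C_r$ ($r\ge2$), $\alpha_r$ long, $\alpha_{r+1}$ adjacent to $\alpha_1$; (C2) $\Delta$ of type $D_n$, $\Delta_P$ of type $D_r$ ($r\ge4$), chain $\alpha_1,\dots,\alpha_{r-2}$ with $\alpha_{r-1},\alpha_r$ adjacent to $\alpha_{r-2}$, $\alpha_{r+1}$ adjacent to $\alpha_1$; (C4) $\Delta$ of type $E_7$ or $E_8$, $\Delta_P$ of type $E_6$, chain $\alpha_1,\dots,\alpha_5$, $\alpha_6$ adjacent to $\alpha_3$, $\alpha_7$ adjacent to $\alpha_1$; or $\Delta$ of type $E_8$, $\Delta_P$ of type $E_7$, chain $\alpha_1,\dots,\alpha_6$, $\alpha_7$ adjacent to $\alpha_4$, $\alpha_8$ adjacent to $\alpha_1$; (C5) $\Delta$ of type $E$, $\Delta_P$ of type $D_5$, chain $\alpha_1,\alpha_2,\alpha_3$, $\alpha_4,\alpha_5$ adjacent to $\alpha_3$, $\alpha_1$ and $\alpha_4$ end nodes of the diagram of $\Delta$, $\alpha_6$ adjacent to $\alpha_5$; (C7) $\Delta$ of type $E$, $\Delta_P$ of type $D_r$ ($4\le r\le7$), chain $\alpha_1,\dots,\alpha_{r-2}$,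 $\alpha_{r-1},\alpha_r$ adjacent to $\alpha_{r-2}$, $\alpha_{r-1}$ an end node of the diagram of $\Delta$, $\alpha_{r+1}$ an end node of the diagram of $\Delta$ adjacent to $\alpha_r$, and a possible second simple root $\alpha_{r+2}\notin\Delta_P$ adjacent to $\alpha_1$; (C9) $\Delta$ of type $F_4$: $r=2$, diagram $\alpha_4-\alpha_1\Rightarrow\alpha_2-\alpha_3$ with $\alpha_4,\alpha_1$ long, $\alpha_2,\alpha_3$ short; or $r=3$, diagram $\alpha_1-\alpha_2\Rightarrow\alpha_3-\alpha_4$ with $\alpha_1,\alpha_2$ long, $\alpha_3,\alpha_4$ short; (C10) $\Delta$ of type $F_4$, $r=3$, diagram $\alpha_1-\alpha_2\Leftarrow\alpha_3-\alpha_4$ with $\alpha_1,\alpha_2$ short, $\alpha_3,\alpha_4$ long. *)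

theory Defs
  imports "HOL-Analysis.Analysis"
begin

section \<open>Root systems\<close>

text \<open>
  Roots and coroots live in one Euclidean space: the coroot of \<open>x\<close> is \<open>2x/(x,x)\<close>,
  and the pairing of a root \<open>x\<close> with an element \<open>l\<close> of the coroot lattice is the inner product
  \<open>x \<bullet> l\<close>.  The coroot lattice of a simply connected group is its cocharacter lattice.
\<close>

definition coroot :: "'a::euclidean_space \<Rightarrow> 'a" where
  "coroot x = (2 / (x \<bullet> x)) *\<^sub>R x"

definition reflection :: "'a::euclidean_space \<Rightarrow> 'a \<Rightarrow> 'a" where
  "reflection x v = v - (v \<bullet> coroot x) *\<^sub>R x"

definition root_system :: "'a::euclidean_space set \<Rightarrow> bool" where
  "root_system R \<longleftrightarrow>
     finite R \<and> 0 \<notin> R \<and> span R = UNIV \<and>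
     (\<forall>x\<in>R. reflection x ` R = R) \<and>
     (\<forall>x\<in>R. \<forall>y\<in>R. x \<bullet> coroot y \<in> \<int>) \<and>
     (\<forall>x\<in>R. \<forall>c::real. c *\<^sub>R x \<in> R \<longrightarrow> c = 1 \<or> c = -1)"

definition irreducible_roots :: "'a::euclidean_space set \<Rightarrow> bool" where
  "irreducible_roots R \<longleftrightarrow>
     R \<noteq> {} \<and>
     \<not> (\<exists>A B. A \<noteq> {} \<and> B \<noteq> {} \<and> A \<inter> B = {} \<and> A \<union> B = R \<and> (\<forall>x\<in>A. \<forall>y\<in>B. x \<bullet> y = 0))"

definition pos_roots :: "'a::euclidean_space set \<Rightarrow> 'a set \<Rightarrow> 'a set" where
  "pos_roots R D = {x\<in>R. \<exists>c::'a \<Rightarrow> nat. x = (\<Sum>a\<in>D. real (c a) *\<^sub>R a)}"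

definition root_base :: "'a::euclidean_space set \<Rightarrow> 'a set \<Rightarrow> bool" where
  "root_base R D \<longleftrightarrow>
     D \<subseteq> R \<and> independent D \<and> span D = UNIV \<and> R = pos_roots R D \<union> uminus ` pos_roots R D"

definition pos_roots_sub :: "'a::euclidean_space set \<Rightarrow> 'a set \<Rightarrow> 'a set \<Rightarrow> 'a set" where
  "pos_roots_sub R D S = pos_roots R D \<inter> span S"

definition coroot_lattice :: "'a::euclidean_space set \<Rightarrow> 'a set" where
  "coroot_lattice D = {\<Sum>a\<in>D. of_int (b a) *\<^sub>R coroot a | b :: 'a \<Rightarrow> int. True}"

section \<open>Weyl groups\<close>

definition refl_word :: "'a::euclidean_space list \<Rightarrow> 'a \<Rightarrow> 'a" where
  "refl_word xs = foldr (\<circ>) (map reflection xs) id"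

definition weyl :: "'a::euclidean_space set \<Rightarrow> ('a \<Rightarrow> 'a) set" where
  "weyl S = {refl_word xs | xs. set xs \<subseteq> S}"

definition weyl_length :: "'a::euclidean_space set \<Rightarrow> ('a \<Rightarrow> 'a) \<Rightarrow> nat" where
  "weyl_length D w = (LEAST k. \<exists>xs. set xs \<subseteq> D \<and> length xs = k \<and> w = refl_word xs)"

definition inversions :: "'a::euclidean_space set \<Rightarrow> 'a set \<Rightarrow> ('a \<Rightarrow> 'a) \<Rightarrow> 'a set" where
  "inversions R D w = {x\<in>pos_roots R D. w x \<in> uminus ` pos_roots R D}"

definition longest :: "'a::euclidean_space set \<Rightarrow> 'a set \<Rightarrow> 'a \<Rightarrow> 'a" where
  "longest D S = (THE w. w \<in> weyl S \<and> (\<forall>v\<in>weyl S. weyl_length D v \<le> weyl_length D w))"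

text \<open>Minimal length representatives of the cosets \<open>w W\<^sub>T\<close> in \<open>W\<^sub>S\<close>.\<close>

definition min_reps :: "'a::euclidean_space set \<Rightarrow> 'a set \<Rightarrow> 'a set \<Rightarrow> ('a \<Rightarrow> 'a) set" where
  "min_reps D S T = {w\<in>weyl S. \<forall>u\<in>weyl T. weyl_length D w \<le> weyl_length D (w \<circ> u)}"

section \<open>Dynkin diagrams\<close>

definition adjacent :: "'a::euclidean_space \<Rightarrow> 'a \<Rightarrow> bool" where
  "adjacent x y \<longleftrightarrow> x \<noteq> y \<and> x \<bullet> y \<noteq> 0"

definition simple_edge :: "'a::euclidean_space \<Rightarrow> 'a \<Rightarrow> bool" where
  "simple_edge x y \<longleftrightarrow> x \<bullet> coroot y = -1 \<and> y \<bullet> coroot x = -1"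

text \<open>A double edge pointing from the long root \<open>x\<close> to the short root \<open>y\<close>.\<close>

definition double_edge :: "'a::euclidean_space \<Rightarrow> 'a \<Rightarrow> bool" where
  "double_edge x y \<longleftrightarrow> x \<bullet> coroot y = -2 \<and> y \<bullet> coroot x = -1"

definition end_node :: "'a::euclidean_space set \<Rightarrow> 'a \<Rightarrow> bool" where
  "end_node D x \<longleftrightarrow> x \<in> D \<and> card {y\<in>D. adjacent x y} = 1"

definition dynkin_connected :: "'a::euclidean_space set \<Rightarrow> bool" where
  "dynkin_connected S \<longleftrightarrow>
     S \<noteq> {} \<and> (\<forall>x\<in>S. \<forall>y\<in>S. (x, y) \<in> {(u, v). u \<in> S \<and> v \<in> S \<and> adjacent u v}\<^sup>*)"

datatype dynkin_type =
  TypeA nat | TypeB nat | TypeC nat | TypeD nat | TypeE nat | TypeF4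

fun type_rank :: "dynkin_type \<Rightarrow> nat" where
  "type_rank (TypeA m) = m"
| "type_rank (TypeB m) = m"
| "type_rank (TypeC m) = m"
| "type_rank (TypeD m) = m"
| "type_rank (TypeE m) = m"
| "type_rank TypeF4 = 4"

definition path_edges :: "nat \<Rightarrow> (nat \<times> nat) set" where
  "path_edges m = {(i, Suc i) | i. 1 \<le> i \<and> i < m}"

text \<open>
  The nodes are \<open>1, \<dots>, m\<close>.  In type \<open>E\<^sub>m\<close> they are not numbered as in Bourbaki: \<open>1, \<dots>, m - 1\<close>
  form a chain and \<open>m\<close> is attached to \<open>m - 3\<close>.
\<close>

fun simple_edges :: "dynkin_type \<Rightarrow> (nat \<times> nat) set" where
  "simple_edges (TypeA m) = path_edges m"
| "simple_edges (TypeB m) = path_edges (m - 1)"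
| "simple_edges (TypeC m) = path_edges (m - 1)"
| "simple_edges (TypeD m) = insert (m - 2, m) (path_edges (m - 1))"
| "simple_edges (TypeE m) = insert (m - 3, m) (path_edges (m - 1))"
| "simple_edges TypeF4 = {(1, 2), (3, 4)}"

text \<open>Pairs (long node, short node).\<close>

fun double_edges :: "dynkin_type \<Rightarrow> (nat \<times> nat) set" where
  "double_edges (TypeB m) = {(m - 1, m)}"
| "double_edges (TypeC m) = {(m, m - 1)}"
| "double_edges TypeF4 = {(2, 3)}"
| "double_edges _ = {}"

definition labelled_as :: "dynkin_type \<Rightarrow> (nat \<Rightarrow> 'a::euclidean_space) \<Rightarrow> bool" where
  "labelled_as X x \<longleftrightarrow>
     inj_on x {1..type_rank X} \<and>
     (\<forall>i\<in>{1..type_rank X}. \<forall>j\<in>{1..type_rank X}. i \<noteq> j \<longrightarrow>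
        (if (i, j) \<in> double_edges X then double_edge (x i) (x j)
         else if (j, i) \<in> double_edges X then double_edge (x j) (x i)
         else if (i, j) \<in> simple_edges X \<or> (j, i) \<in> simple_edges X then simple_edge (x i) (x j)
         else x i \<bullet> x j = 0))"

definition of_type :: "'a::euclidean_space set \<Rightarrow> dynkin_type \<Rightarrow> bool" where
  "of_type S X \<longleftrightarrow> (\<exists>x. x ` {1..type_rank X} = S \<and> labelled_as X x)"

section \<open>Orderings of the simple roots\<close>

text \<open>
  Throughout, \<open>\<alpha> 1, \<dots>, \<alpha> n\<close> are the simple roots and \<open>\<alpha> 1, \<dots>, \<alpha> r\<close> those of the parabolic
  subgroup.
\<close>

definition ordering_C1B :: "(nat \<Rightarrow> 'a::euclidean_space) \<Rightarrow> nat \<Rightarrow> nat \<Rightarrow> bool" where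
  "ordering_C1B \<alpha> n r \<longleftrightarrow>
     of_type (\<alpha> ` {1..n}) (TypeB n) \<and> 2 \<le> r \<and> labelled_as (TypeB r) \<alpha> \<and>
     simple_edge (\<alpha> (r + 1)) (\<alpha> 1)"

definition ordering_C1C :: "(nat \<Rightarrow> 'a::euclidean_space) \<Rightarrow> nat \<Rightarrow> nat \<Rightarrow> bool" where
  "ordering_C1C \<alpha> n r \<longleftrightarrow>
     of_type (\<alpha> ` {1..n}) (TypeC n) \<and> 2 \<le> r \<and> labelled_as (TypeC r) \<alpha> \<and>
     simple_edge (\<alpha> (r + 1)) (\<alpha> 1)"

definition ordering_C2 :: "(nat \<Rightarrow> 'a::euclidean_space) \<Rightarrow> nat \<Rightarrow> nat \<Rightarrow> bool" where
  "ordering_C2 \<alpha> n r \<longleftrightarrow>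
     of_type (\<alpha> ` {1..n}) (TypeD n) \<and> 4 \<le> r \<and> labelled_as (TypeD r) \<alpha> \<and>
     simple_edge (\<alpha> (r + 1)) (\<alpha> 1)"

definition ordering_C4 :: "(nat \<Rightarrow> 'a::euclidean_space) \<Rightarrow> nat \<Rightarrow> nat \<Rightarrow> bool" where
  "ordering_C4 \<alpha> n r \<longleftrightarrow>
     (n \<in> {7, 8} \<and> of_type (\<alpha> ` {1..n}) (TypeE n) \<and> r = 6 \<and> labelled_as (TypeE 6) \<alpha> \<and>
        simple_edge (\<alpha> 7) (\<alpha> 1)) \<or>
     (n = 8 \<and> of_type (\<alpha> ` {1..n}) (TypeE 8) \<and> r = 7 \<and> labelled_as (TypeE 7) \<alpha> \<and>
        simple_edge (\<alpha> 8) (\<alpha> 1))"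

definition ordering_C5 :: "(nat \<Rightarrow> 'a::euclidean_space) \<Rightarrow> nat \<Rightarrow> nat \<Rightarrow> bool" where
  "ordering_C5 \<alpha> n r \<longleftrightarrow>
     n \<in> {6, 7, 8} \<and> of_type (\<alpha> ` {1..n}) (TypeE n) \<and> r = 5 \<and> labelled_as (TypeD 5) \<alpha> \<and>
     end_node (\<alpha> ` {1..n}) (\<alpha> 1) \<and> end_node (\<alpha> ` {1..n}) (\<alpha> 4) \<and>
     simple_edge (\<alpha> 6) (\<alpha> 5)"

text \<open>
  In the next case a simple root outside the parabolic, other than \<open>\<alpha> (r + 1)\<close>, may be adjacent to
  one of \<open>\<alpha> 1, \<dots>, \<alpha> r\<close>; if there is such a root, then it is \<open>\<alpha> (r + 2)\<close> and adjacent to \<open>\<alpha> 1\<close>.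
\<close>

definition ordering_C7 :: "(nat \<Rightarrow> 'a::euclidean_space) \<Rightarrow> nat \<Rightarrow> nat \<Rightarrow> bool" where
  "ordering_C7 \<alpha> n r \<longleftrightarrow>
     n \<in> {6, 7, 8} \<and> of_type (\<alpha> ` {1..n}) (TypeE n) \<and> 4 \<le> r \<and> r \<le> 7 \<and>
     labelled_as (TypeD r) \<alpha> \<and>
     end_node (\<alpha> ` {1..n}) (\<alpha> (r - 1)) \<and> end_node (\<alpha> ` {1..n}) (\<alpha> (r + 1)) \<and>
     simple_edge (\<alpha> (r + 1)) (\<alpha> r) \<and>
     (\<forall>k\<in>{r + 2..n}. (\<exists>i\<in>{1..r}. adjacent (\<alpha> k) (\<alpha> i)) \<longrightarrow>
        k = r + 2 \<and> simple_edge (\<alpha> k) (\<alpha> 1))"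

definition ordering_C9 :: "(nat \<Rightarrow> 'a::euclidean_space) \<Rightarrow> nat \<Rightarrow> nat \<Rightarrow> bool" where
  "ordering_C9 \<alpha> n r \<longleftrightarrow>
     n = 4 \<and> of_type (\<alpha> ` {1..n}) TypeF4 \<and>
     ((r = 2 \<and> simple_edge (\<alpha> 4) (\<alpha> 1) \<and> double_edge (\<alpha> 1) (\<alpha> 2) \<and> simple_edge (\<alpha> 2) (\<alpha> 3)) \<or>
      (r = 3 \<and> simple_edge (\<alpha> 1) (\<alpha> 2) \<and> double_edge (\<alpha> 2) (\<alpha> 3) \<and> simple_edge (\<alpha> 3) (\<alpha> 4)))"

definition ordering_C10 :: "(nat \<Rightarrow> 'a::euclidean_space) \<Rightarrow> nat \<Rightarrow> nat \<Rightarrow> bool" where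
  "ordering_C10 \<alpha> n r \<longleftrightarrow>
     n = 4 \<and> of_type (\<alpha> ` {1..n}) TypeF4 \<and> r = 3 \<and>
     simple_edge (\<alpha> 1) (\<alpha> 2) \<and> double_edge (\<alpha> 3) (\<alpha> 2) \<and> simple_edge (\<alpha> 3) (\<alpha> 4)"

definition listed_ordering :: "(nat \<Rightarrow> 'a::euclidean_space) \<Rightarrow> nat \<Rightarrow> nat \<Rightarrow> bool" where
  "listed_ordering \<alpha> n r \<longleftrightarrow>
     ordering_C1B \<alpha> n r \<or> ordering_C1C \<alpha> n r \<or> ordering_C2 \<alpha> n r \<or> ordering_C4 \<alpha> n r \<or>
     ordering_C5 \<alpha> n r \<or> ordering_C7 \<alpha> n r \<or> ordering_C9 \<alpha> n r \<or> ordering_C10 \<alpha> n r"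

section \<open>The grading maps\<close>

text \<open>
  An element of \<open>\<int>\<^sup>r\<^sup>+\<^sup>1\<close> is a function \<open>nat \<Rightarrow> int\<close> vanishing outside \<open>{1..r + 1}\<close>.
\<close>

definition unit_vec :: "nat \<Rightarrow> nat \<Rightarrow> int" where
  "unit_vec i = (\<lambda>k. if k = i then 1 else 0)"

definition level :: "(nat \<Rightarrow> 'a) \<Rightarrow> nat \<Rightarrow> nat \<Rightarrow> nat \<Rightarrow> 'a set" where
  "level \<alpha> n r j = (if j \<le> r then \<alpha> ` {1..j} else \<alpha> ` {1..n})"

definition level_roots ::
    "'a::euclidean_space set \<Rightarrow> (nat \<Rightarrow> 'a) \<Rightarrow> nat \<Rightarrow> nat \<Rightarrow> nat \<Rightarrow> 'a set" where
  "level_roots R \<alpha> n r i =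
     pos_roots_sub R (\<alpha> ` {1..n}) (level \<alpha> n r i) -
     pos_roots_sub R (\<alpha> ` {1..n}) (level \<alpha> n r (i - 1))"

text \<open>
  For a root \<open>\<beta>\<close> and \<open>l\<close> in the coroot lattice, \<open>\<beta> \<bullet> l\<close> is an integer and the floor below
  only changes its type.
\<close>

definition gr ::
    "'a::euclidean_space set \<Rightarrow> (nat \<Rightarrow> 'a) \<Rightarrow> nat \<Rightarrow> nat \<Rightarrow> ('a \<Rightarrow> 'a) \<Rightarrow> 'a \<Rightarrow> nat \<Rightarrow> int" where
  "gr R \<alpha> n r w l = (\<lambda>m. \<Sum>i=1..r + 1.
     (int (card (inversions R (\<alpha> ` {1..n}) w \<inter> level_roots R \<alpha> n r i))
       + (\<Sum>\<beta>\<in>level_roots R \<alpha> n r i. \<lfloor>\<beta> \<bullet> l\<rfloor>)) * unit_vec i m)"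

text \<open>
  The factors \<open>v\<^sub>j\<close> of \<open>w = v\<^sub>r\<^sub>+\<^sub>1 \<circ> \<dots> \<circ> v\<^sub>1\<close>.  Outside \<open>{1..r + 1}\<close> the function \<open>v\<close> is set to a
  fixed value, so that it is determined by \<open>w\<close>; the same convention is used for the coefficient
  families further below.
\<close>

definition decomp ::
    "(nat \<Rightarrow> 'a::euclidean_space) \<Rightarrow> nat \<Rightarrow> nat \<Rightarrow> ('a \<Rightarrow> 'a) \<Rightarrow> nat \<Rightarrow> 'a \<Rightarrow> 'a" where
  "decomp \<alpha> n r w = (THE v.
     (\<forall>j\<in>{1..r + 1}. v j \<in> min_reps (\<alpha> ` {1..n}) (level \<alpha> n r j) (level \<alpha> n r (j - 1))) \<and>
     (\<forall>j. j \<notin> {1..r + 1} \<longrightarrow> v j = id) \<and>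
     w = fold (\<lambda>j u. v j \<circ> u) [1..<r + 2] id)"

definition gr'_weyl ::
    "(nat \<Rightarrow> 'a::euclidean_space) \<Rightarrow> nat \<Rightarrow> nat \<Rightarrow> ('a \<Rightarrow> 'a) \<Rightarrow> nat \<Rightarrow> int" where
  "gr'_weyl \<alpha> n r w = (\<lambda>m. \<Sum>i=1..r + 1.
     int (weyl_length (\<alpha> ` {1..n}) (decomp \<alpha> n r w i)) * unit_vec i m)"

text \<open>
  \<open>lift_coeffs R \<alpha> n r k j\<close> are the integers \<open>a\<^sub>1, \<dots>, a\<^sub>j\<close> such that the element
  \<open>\<alpha>\<^sub>k\<^sup>\<or> + \<Sum> a\<^sub>i \<alpha>\<^sub>i\<^sup>\<or>\<close> pairs to \<open>0\<close> or \<open>-1\<close> with all positive roots of level \<open>j\<close>, and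
  \<open>lift_elt\<close> is this element.
\<close>

definition lift_coeffs ::
    "'a::euclidean_space set \<Rightarrow> (nat \<Rightarrow> 'a) \<Rightarrow> nat \<Rightarrow> nat \<Rightarrow> nat \<Rightarrow> nat \<Rightarrow> nat \<Rightarrow> int" where
  "lift_coeffs R \<alpha> n r k j = (THE a.
     (\<forall>i. i \<notin> {1..j} \<longrightarrow> a i = 0) \<and>
     (\<forall>\<gamma>\<in>pos_roots_sub R (\<alpha> ` {1..n}) (level \<alpha> n r j).
        \<gamma> \<bullet> (coroot (\<alpha> k) + (\<Sum>i=1..j. of_int (a i) *\<^sub>R coroot (\<alpha> i))) \<in> {0, -1}))"

definition lift_elt ::
    "'a::euclidean_space set \<Rightarrow> (nat \<Rightarrow> 'a) \<Rightarrow> nat \<Rightarrow> nat \<Rightarrow> nat \<Rightarrow> nat \<Rightarrow> 'a" where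
  "lift_elt R \<alpha> n r k j =
     coroot (\<alpha> k) + (\<Sum>i=1..j. of_int (lift_coeffs R \<alpha> n r k j i) *\<^sub>R coroot (\<alpha> i))"

text \<open>
  With \<open>S = \<Delta>\<^sub>j\<close> and \<open>S'\<close> the subset orthogonal to \<open>lift_elt\<close>, this is \<open>w\<^sub>P w\<^sub>P\<^sub>'\<close> for the
  parabolics \<open>P\<close>, \<open>P'\<close> attached to \<open>S\<close>, \<open>S'\<close>.
\<close>

definition lift_weyl ::
    "'a::euclidean_space set \<Rightarrow> (nat \<Rightarrow> 'a) \<Rightarrow> nat \<Rightarrow> nat \<Rightarrow> nat \<Rightarrow> nat \<Rightarrow> 'a \<Rightarrow> 'a" where
  "lift_weyl R \<alpha> n r k j =
     (let D = \<alpha> ` {1..n}; S = level \<alpha> n r j; S' = {\<beta>\<in>S. \<beta> \<bullet> lift_elt R \<alpha> n r k j = 0}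
      in longest D S \<circ> longest D S')"

text \<open>
  \<open>gr'_coroot R \<alpha> n r k\<close> is the value of \<open>gr'\<close> at (\<open>id\<close>, \<open>\<alpha>\<^sub>k\<^sup>\<or>\<close>).  For \<open>2 \<le> k \<le> n\<close>, the index \<open>j\<close>
  with \<open>1 \<le> j \<le> r\<close> and \<open>\<alpha>\<^sub>k \<in> \<Delta>\<^sub>j\<^sub>+\<^sub>1 - \<Delta>\<^sub>j\<close> is \<open>min (k - 1) r\<close>: it is \<open>k - 1\<close> for the simple roots of
  the parabolic, and \<open>r\<close> for the others.
\<close>

function gr'_coroot ::
    "'a::euclidean_space set \<Rightarrow> (nat \<Rightarrow> 'a) \<Rightarrow> nat \<Rightarrow> nat \<Rightarrow> nat \<Rightarrow> nat \<Rightarrow> int" where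
  "gr'_coroot R \<alpha> n r k =
     (if k \<le> 1 then (\<lambda>m. 2 * unit_vec 1 m)
      else let j = min (k - 1) r; a = lift_coeffs R \<alpha> n r k j; u = lift_weyl R \<alpha> n r k j
        in (\<lambda>m. (int (weyl_length (\<alpha> ` {1..n}) u) + 2 + (\<Sum>i=1..j. 2 * a i)) * unit_vec (j + 1) m
                - gr'_weyl \<alpha> n r u m
                - (\<Sum>i=1..j. a i * gr'_coroot R \<alpha> n r i m)))"
  by pat_completeness auto
termination
  by (relation "Wellfounded.measure (\<lambda>(R, \<alpha>, n, r, k). k)") auto

declare gr'_coroot.simps [simp del]

definition coroot_coeffs :: "(nat \<Rightarrow> 'a::euclidean_space) \<Rightarrow> nat \<Rightarrow> 'a \<Rightarrow> nat \<Rightarrow> int" where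
  "coroot_coeffs \<alpha> n l = (THE b.
     (\<forall>k. k \<notin> {1..n} \<longrightarrow> b k = 0) \<and> l = (\<Sum>k=1..n. of_int (b k) *\<^sub>R coroot (\<alpha> k)))"

definition gr' ::
    "'a::euclidean_space set \<Rightarrow> (nat \<Rightarrow> 'a) \<Rightarrow> nat \<Rightarrow> nat \<Rightarrow> ('a \<Rightarrow> 'a) \<Rightarrow> 'a \<Rightarrow> nat \<Rightarrow> int" where
  "gr' R \<alpha> n r w l = (\<lambda>m.
     gr'_weyl \<alpha> n r w m + (\<Sum>k=1..n. coroot_coeffs \<alpha> n l k * gr'_coroot R \<alpha> n r k m))"

end

theory Submission
  imports Defs
begin

text \<open>
  Both gradings are a function of \<open>w\<close> plus an additive function of the coroot lattice element, so
  it suffices to compare them on Weyl group elements and on simple coroots.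

  On \<open>w = v\<^sub>r\<^sub>+\<^sub>1 \<circ> \<dots> \<circ> v\<^sub>1\<close>, only the factor \<open>v\<^sub>i\<close> matters in degree \<open>i\<close>.  The later factors are minimal
  coset representatives and keep the roots of level \<open>i\<close> on their side, while the earlier factors
  lie in the parabolic subgroup of level \<open>i - 1\<close> and permute the positive roots that are of level \<open>i\<close>
  but not of level \<open>i - 1\<close>.  Hence \<open>w\<close> has as many inversions among these roots as \<open>v\<^sub>i\<close> has
  altogether, and their number is the length of \<open>v\<^sub>i\<close> (\<open>card_inversions_level_product\<close>,
  \<open>weyl_length_eq_card_inv_set\<close>).

  On coroots, the recursion for \<open>gr'\<close> expresses that the value at \<open>(u, l)\<close> is concentrated in degree
  \<open>j + 1\<close>, where \<open>l\<close> is the lift of \<open>\<alpha>\<^sub>k\<^sup>\<or>\<close> and \<open>u\<close> is the product of two longest elements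
  attached to it.  The map \<open>gr\<close> obeys the same recursion (\<open>level_sum_lift_elt\<close>):
  \<^item> The inversions of \<open>u\<close> are the positive roots of level \<open>j\<close> that pair to \<open>-1\<close> with \<open>l\<close>, all others of
    that level pairing to \<open>0\<close>.  In degrees up to \<open>j\<close>, pairings and inversions thus cancel.
  \<^item> The sum \<open>2\<rho>\<close> of the positive roots of a level pairs to \<open>2\<close> with each simple coroot of that level
    (\<open>sum_pos_in_coroot\<close>).  In degrees above \<open>j + 1\<close> the pairing with \<open>l\<close> is therefore a difference of two
    equal numbers.
  \<^item> In degree \<open>j + 1\<close> it is the pairing of \<open>l\<close> with \<open>2\<rho>\<close> of level \<open>j + 1\<close>, which is twice the sum of the
    coefficients of \<open>l\<close>, minus the pairing with \<open>2\<rho>\<close> of level \<open>j\<close>, which is minus the length of \<open>u\<close>.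

  The lift \<open>l\<close> is given by a definite description and needs existence and uniqueness
  (\<open>minuscule_representative_exists\<close>, \<open>lattice_minuscule_zero\<close>).  It is the most antidominant among the
  elements of its coset that are
  shortest with respect to \<open>root_form\<close>.
\<close>

section \<open>Reflections and words\<close>

lemma linear_reflection: "linear (reflection x)"
  unfolding reflection_def by (auto intro!: linearI simp: algebra_simps inner_add_left)

lemma inner_coroot_self: "x \<noteq> 0 \<Longrightarrow> x \<bullet> coroot x = 2"
  by (simp add: coroot_def)

lemma reflection_self: "reflection x x = - x"
  by (cases "x = 0") (simp_all add: reflection_def inner_coroot_self scaleR_2 coroot_def)

lemma inner_reflection: "reflection x u \<bullet> reflection x v = u \<bullet> v"
  by (cases "x = 0")
    (simp_all add: reflection_def coroot_def inner_diff_left inner_diff_right inner_commute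
      field_simps)

lemma reflection_reflection: "reflection x (reflection x v) = v"
proof -
  have "reflection x v \<bullet> coroot x = - (v \<bullet> coroot x)"
    by (cases "x = 0") (simp_all add: reflection_def inner_diff_left inner_coroot_self coroot_def)
  then show ?thesis
    by (simp add: reflection_def)
qed

lemma reflection_o_reflection: "reflection x \<circ> reflection x = id"
  by (simp add: fun_eq_iff reflection_reflection)

lemma refl_word_simps [simp]:
  "refl_word [] = id" "refl_word (x # xs) = reflection x \<circ> refl_word xs"
  by (simp_all add: refl_word_def)

lemma refl_word_append: "refl_word (xs @ ys) = refl_word xs \<circ> refl_word ys"
  by (induction xs) (simp_all add: o_assoc)

lemma refl_word_snoc: "refl_word (xs @ [x]) = refl_word xs \<circ> reflection x"
  by (simp only: refl_word_append refl_word_simps o_id)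

lemma weyl_id: "id \<in> weyl S"
  unfolding weyl_def by (metis (mono_tags, lifting) empty_subsetI list.set(1) mem_Collect_eq
      refl_word_simps(1))

lemma weyl_reflection: "x \<in> S \<Longrightarrow> reflection x \<in> weyl S"
  unfolding weyl_def by (auto intro!: exI[of _ "[x]"])

lemma weyl_comp: "u \<in> weyl S \<Longrightarrow> v \<in> weyl S \<Longrightarrow> u \<circ> v \<in> weyl S"
  unfolding weyl_def by clarsimp (metis refl_word_append set_append Un_least)

lemma weyl_mono: "S \<subseteq> T \<Longrightarrow> weyl S \<subseteq> weyl T"
  unfolding weyl_def by auto

lemma weyl_empty: "w \<in> weyl {} \<Longrightarrow> w = id"
  by (auto simp: weyl_def)

lemma weyl_induct [consumes 1, case_names id reflection]:
  assumes "w \<in> weyl S" and "P id"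
    and "\<And>x w. x \<in> S \<Longrightarrow> w \<in> weyl S \<Longrightarrow> P w \<Longrightarrow> P (reflection x \<circ> w)"
  shows "P w"
proof -
  have "P (refl_word xs)" if "set xs \<subseteq> S" for xs
    using that
  proof (induction xs)
    case (Cons x xs)
    then have "refl_word xs \<in> weyl S" by (auto simp: weyl_def)
    with Cons assms(3)[of x "refl_word xs"] show ?case by (simp add: o_def)
  qed (simp add: assms(2))
  with assms(1) show ?thesis by (auto simp: weyl_def)
qed

lemma weyl_inverse:
  assumes "w \<in> weyl S"
  obtains w' where "w' \<in> weyl S" "w' \<circ> w = id" "w \<circ> w' = id"
proof -
  from assms have "\<exists>w'\<in>weyl S. w' \<circ> w = id \<and> w \<circ> w' = id"
  proof (induction rule: weyl_induct)
    case id
    show ?case by (rule bexI[OF _ weyl_id]) simp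
  next
    case (reflection x w)
    then obtain w' where w': "w' \<in> weyl S" "w' \<circ> w = id" "w \<circ> w' = id" by blast
    show ?case
    proof (intro bexI conjI)
      show "w' \<circ> reflection x \<in> weyl S"
        using w' reflection by (intro weyl_comp weyl_reflection)
      show "w' \<circ> reflection x \<circ> (reflection x \<circ> w) = id"
        using w'(2) by (simp add: fun_eq_iff reflection_reflection)
      show "reflection x \<circ> w \<circ> (w' \<circ> reflection x) = id"
        using w'(3) by (simp add: fun_eq_iff reflection_reflection)
    qed
  qed
  with that show thesis by blast
qed

lemma linear_weyl: "w \<in> weyl S \<Longrightarrow> linear w"
proof (induction rule: weyl_induct)
  case id
  show ?case by (simp add: id_def linear_ident)
next
  case (reflection x w)
  then show ?case by (intro linear_compose linear_reflection)
qed

lemma weyl_uminus: "w \<in> weyl S \<Longrightarrow> w (- x) = - w x"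
  by (rule linear_neg[OF linear_weyl])

lemma inner_weyl: "w \<in> weyl S \<Longrightarrow> w x \<bullet> w y = x \<bullet> y"
  by (induction rule: weyl_induct) (simp_all add: inner_reflection)

lemma weyl_minus_in_span: "w \<in> weyl S \<Longrightarrow> w x - x \<in> span S"
proof (induction rule: weyl_induct)
  case (reflection y w)
  have "(reflection y \<circ> w) x - x = (w x - x) - (w x \<bullet> coroot y) *\<^sub>R y"
    by (simp add: reflection_def)
  also have "\<dots> \<in> span S"
    using reflection by (metis span_diff span_scale span_base)
  finally show ?case .
qed (simp add: span_zero)

lemma weyl_reflection_conjugate:
  assumes "w \<in> weyl S"
  shows "w \<circ> reflection x = reflection (w x) \<circ> w"
proof
  fix v
  show "(w \<circ> reflection x) v = (reflection (w x) \<circ> w) v"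
    using linear_weyl[OF assms]
    by (simp add: reflection_def coroot_def inner_weyl[OF assms] linear_diff linear_cmul)
qed

section \<open>Signs of roots and lengths in the Weyl group\<close>

locale based_root_system =
  fixes R D :: "'a::euclidean_space set"
  assumes rs: "root_system R" and base: "root_base R D"
begin

abbreviation coeff :: "'a \<Rightarrow> 'a \<Rightarrow> real" where
  "coeff \<equiv> representation D"

abbreviation pos :: "'a set" where
  "pos \<equiv> pos_roots R D"

abbreviation neg :: "'a set" where
  "neg \<equiv> uminus ` pos"

abbreviation pos_in :: "'a set \<Rightarrow> 'a set" where
  "pos_in S \<equiv> pos_roots_sub R D S"

abbreviation inv_set :: "('a \<Rightarrow> 'a) \<Rightarrow> 'a set" where
  "inv_set w \<equiv> inversions R D w"

lemma finite_roots: "finite R" and zero_not_root: "0 \<notin> R"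
  and reflection_image: "x \<in> R \<Longrightarrow> reflection x ` R = R"
  and pairing_Ints: "x \<in> R \<Longrightarrow> y \<in> R \<Longrightarrow> x \<bullet> coroot y \<in> \<int>"
  and root_multiple: "x \<in> R \<Longrightarrow> c *\<^sub>R x \<in> R \<Longrightarrow> c = 1 \<or> c = - 1"
  using rs unfolding root_system_def by blast+

lemma base_subset: "D \<subseteq> R" and independent_base: "independent D" and span_base_UNIV: "span D = UNIV"
  and roots_split: "R = pos \<union> neg"
  using base unfolding root_base_def by blast+

lemma finite_base: "finite D"
  using base_subset finite_roots by (rule finite_subset)

lemma pos_subset: "pos \<subseteq> R"
  by (auto simp: pos_roots_def)

lemma finite_pos: "finite pos"
  using pos_subset finite_roots by (rule finite_subset)

lemma root_cases: "x \<in> R \<Longrightarrow> x \<in> pos \<or> - x \<in> pos"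
  using roots_split by force

lemma neg_iff: "x \<in> neg \<longleftrightarrow> - x \<in> pos"
  by force

lemma uminus_root: "x \<in> R \<Longrightarrow> - x \<in> R"
  using roots_split by (metis UnCI UnE neg_iff minus_minus)

lemma coeff_scale: "coeff (c *\<^sub>R x) a = c * coeff x a"
  by (simp add: representation_scale[OF independent_base] span_base_UNIV)

lemma coeff_simple: "a \<in> D \<Longrightarrow> coeff a b = (if b = a then 1 else 0)"
  by (rule representation_basis[OF independent_base, THEN fun_cong, THEN trans]) auto

lemma coeff_of_sum: "coeff (sum f A) b = (\<Sum>x\<in>A. coeff (f x) b)"
  by (rule representation_sum[OF independent_base, THEN fun_cong]) (simp add: span_base_UNIV)

lemma coeff_combination: "b \<in> D \<Longrightarrow> coeff (\<Sum>a\<in>D. c a *\<^sub>R a) b = c b"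
  using finite_base
  by (simp add: coeff_of_sum coeff_scale coeff_simple if_distrib sum.delta cong: sum.cong if_cong)

lemma coeff_expand: "(\<Sum>a\<in>D. coeff x a *\<^sub>R a) = x"
  using independent_base finite_base by (intro sum_representation_eq) (auto simp: span_base_UNIV)

lemma coeff_diff: "coeff (x - y) a = coeff x a - coeff y a"
proof -
  have "x \<in> span D" "y \<in> span D"
    by (simp_all add: span_base_UNIV)
  from representation_diff[OF independent_base this(2,1)] show ?thesis by (rule fun_cong)
qed

lemma coeff_uminus: "coeff (- x) a = - coeff x a"
  using coeff_scale[of "- 1" x a] by simp

lemma coeff_nonneg: "x \<in> pos \<Longrightarrow> a \<in> D \<Longrightarrow> coeff x a \<ge> 0"
  by (auto simp: pos_roots_def coeff_combination)

lemma uminus_pos: "x \<in> pos \<Longrightarrow> - x \<notin> pos"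
proof
  assume x: "x \<in> pos" "- x \<in> pos"
  have "coeff x a = 0" if "a \<in> D" for a
    using coeff_nonneg[OF x(1) that] coeff_nonneg[OF x(2) that] by (simp add: coeff_uminus)
  then have "x = 0"
    using coeff_expand[of x] by simp
  with x(1) pos_subset zero_not_root show False by blast
qed

lemma pos_if_coeff_pos: "x \<in> R \<Longrightarrow> a \<in> D \<Longrightarrow> coeff x a > 0 \<Longrightarrow> x \<in> pos"
  using root_cases coeff_nonneg[of "- x" a] by (fastforce simp: coeff_uminus)

lemma in_span_iff:
  assumes "S \<subseteq> D"
  shows "x \<in> span S \<longleftrightarrow> (\<forall>a\<in>D - S. coeff x a = 0)"
proof
  assume "x \<in> span S"
  then have "coeff x = representation S x"
    using independent_base assms by (intro representation_extend)
  then show "\<forall>a\<in>D - S. coeff x a = 0"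
    by (metis DiffD2 representation_ne_zero)
next
  assume zero: "\<forall>a\<in>D - S. coeff x a = 0"
  have "(\<Sum>a\<in>S. coeff x a *\<^sub>R a) = (\<Sum>a\<in>D. coeff x a *\<^sub>R a)"
    using assms finite_base zero by (intro sum.mono_neutral_left) auto
  moreover have "(\<Sum>a\<in>S. coeff x a *\<^sub>R a) \<in> span S"
    by (intro span_sum span_scale span_base)
  ultimately show "x \<in> span S"
    by (simp add: coeff_expand)
qed

lemma span_expand:
  assumes "S \<subseteq> D" "x \<in> span S"
  shows "(\<Sum>a\<in>S. coeff x a *\<^sub>R a) = x"
proof -
  have "(\<Sum>a\<in>D. coeff x a *\<^sub>R a) = (\<Sum>a\<in>S. coeff x a *\<^sub>R a)"
    using assms finite_base in_span_iff[OF assms(1)] by (intro sum.mono_neutral_right) auto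
  then show ?thesis by (simp add: coeff_expand)
qed

lemma base_pos: "a \<in> D \<Longrightarrow> a \<in> pos"
  using base_subset by (intro pos_if_coeff_pos[of _ a]) (auto simp: coeff_simple)

lemma finite_pos_in: "finite (pos_in S)"
  unfolding pos_roots_sub_def using finite_pos by blast

lemma pos_in_empty: "pos_in {} = {}"
  using pos_subset zero_not_root by (auto simp: pos_roots_sub_def)

lemma pos_in_mono: "S \<subseteq> T \<Longrightarrow> pos_in S \<subseteq> pos_in T"
  unfolding pos_roots_sub_def using span_mono by blast

text \<open>
  A positive root other than \<open>a\<close> involves some other simple root, and its coefficient there is not
  changed by \<open>reflection a\<close>.
\<close>

lemma simple_reflection_pos:
  assumes "a \<in> D" "x \<in> pos" "x \<noteq> a"
  shows "reflection a x \<in> pos"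
proof -
  have "\<exists>b\<in>D - {a}. coeff x b \<noteq> 0"
  proof (rule ccontr)
    assume "\<not> ?thesis"
    then have "(\<Sum>b\<in>D. coeff x b *\<^sub>R b) = (\<Sum>b\<in>{a}. coeff x b *\<^sub>R b)"
      using assms(1) finite_base by (intro sum.mono_neutral_right) auto
    then have x: "x = coeff x a *\<^sub>R a"
      by (simp add: coeff_expand)
    then have "coeff x a = 1 \<or> coeff x a = - 1"
      using root_multiple assms base_subset pos_subset by (metis subsetD)
    with coeff_nonneg[OF assms(2,1)] x assms(3) show False
      by auto
  qed
  then obtain b where b: "b \<in> D" "b \<noteq> a" "coeff x b \<noteq> 0" by blast
  have "coeff (reflection a x) b = coeff x b"
    using b assms(1) by (simp add: reflection_def coeff_diff coeff_scale coeff_simple)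
  moreover have "coeff x b > 0"
    using b coeff_nonneg[OF assms(2)] by force
  moreover have "reflection a x \<in> R"
    using reflection_image assms(1,2) base_subset pos_subset by blast
  ultimately show ?thesis
    using b(1) pos_if_coeff_pos by simp
qed

lemma weyl_root: "w \<in> weyl S \<Longrightarrow> S \<subseteq> R \<Longrightarrow> x \<in> R \<Longrightarrow> w x \<in> R"
  by (induction rule: weyl_induct) (use reflection_image in auto)

lemma weyl_in_span_iff:
  assumes "w \<in> weyl S" "S \<subseteq> T"
  shows "w x \<in> span T \<longleftrightarrow> x \<in> span T"
proof -
  have "w x - x \<in> span T"
    using weyl_minus_in_span[OF assms(1)] span_mono[OF assms(2)] by blast
  then show ?thesis
    by (metis diff_add_cancel span_add_eq)
qed

text \<open>
  An element of a parabolic subgroup changes a root by a combination of \<open>S\<close> only, so it cannot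
  change the sign of a root with a nonzero coefficient outside \<open>S\<close>.
\<close>

lemma weyl_pos_outside:
  assumes "w \<in> weyl S" "S \<subseteq> D" "x \<in> pos" "x \<notin> span S"
  shows "w x \<in> pos"
proof -
  obtain a where a: "a \<in> D - S" "coeff x a \<noteq> 0"
    using assms(2,4) in_span_iff by blast
  have "coeff (w x - x) a = 0"
    using weyl_minus_in_span[OF assms(1)] assms(2) a(1) in_span_iff by blast
  then have "coeff (w x) a > 0"
    using a coeff_nonneg[OF assms(3), of a] by (simp add: coeff_diff)
  moreover have "w x \<in> R"
    using assms base_subset pos_subset by (intro weyl_root[of w S]) auto
  ultimately show ?thesis
    using a(1) pos_if_coeff_pos by blast
qed

lemma weyl_neg_in_span:
  "w \<in> weyl S \<Longrightarrow> S \<subseteq> D \<Longrightarrow> x \<in> pos \<Longrightarrow> w x \<in> neg \<Longrightarrow> x \<in> span S"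
  using weyl_pos_outside uminus_pos neg_iff by blast

lemma inv_set_subset: "w \<in> weyl S \<Longrightarrow> S \<subseteq> D \<Longrightarrow> inv_set w \<subseteq> pos_in S"
  by (auto simp: inversions_def pos_roots_sub_def dest: weyl_neg_in_span)

lemma finite_inv_set: "finite (inv_set w)"
  unfolding inversions_def using finite_pos by simp

text \<open>
  Positive roots in the span of \<open>S\<close> are nonnegative combinations of \<open>S\<close>, so their signs under a
  linear map preserving the roots are controlled by the simple roots in \<open>S\<close>.  The map need not be in
  the Weyl group: applied to the negative of a Weyl group element, this treats negative images too.
\<close>

lemma pos_if_simple_pos:
  assumes f: "linear f" "\<And>x. x \<in> R \<Longrightarrow> f x \<in> R"
    and S: "S \<subseteq> D" "\<And>a. a \<in> S \<Longrightarrow> f a \<in> pos" and x: "x \<in> pos_in S"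
  shows "f x \<in> pos"
proof (rule ccontr)
  assume "f x \<notin> pos"
  have xS: "x \<in> pos" "x \<in> span S"
    using x by (auto simp: pos_roots_sub_def)
  have fx: "f x \<in> R"
    using f xS pos_subset by blast
  then have neg: "- f x \<in> pos"
    using root_cases \<open>f x \<notin> pos\<close> by blast
  have "coeff (f x) b = 0" if b: "b \<in> D" for b
  proof -
    have "f x = (\<Sum>a\<in>S. coeff x a *\<^sub>R f a)"
      using f(1) by (subst span_expand[OF S(1) xS(2), symmetric]) (simp only: linear_sum linear_cmul)
    then have "coeff (f x) b = (\<Sum>a\<in>S. coeff x a * coeff (f a) b)"
      by (simp add: coeff_of_sum coeff_scale)
    also have "\<dots> \<ge> 0"
      using S b xS(1) coeff_nonneg by (intro sum_nonneg mult_nonneg_nonneg) auto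
    finally show ?thesis
      using coeff_nonneg[OF neg b] by (simp add: coeff_uminus)
  qed
  then have "f x = 0"
    using coeff_expand[of "f x"] by simp
  with fx zero_not_root show False by simp
qed

lemma weyl_pos_if_simple_pos:
  assumes "w \<in> weyl D" "S \<subseteq> D" "\<And>a. a \<in> S \<Longrightarrow> w a \<in> pos" "x \<in> pos_in S"
  shows "w x \<in> pos"
  using linear_weyl[OF assms(1)] weyl_root[OF assms(1) base_subset] assms(2-4)
  by (rule pos_if_simple_pos)

lemma weyl_neg_if_simple_neg:
  assumes "w \<in> weyl D" "S \<subseteq> D" "\<And>a. a \<in> S \<Longrightarrow> - w a \<in> pos" "x \<in> pos_in S"
  shows "- w x \<in> pos"
proof -
  have "linear (\<lambda>x. - w x)"
    using linear_weyl[OF assms(1)] by (rule linear_compose_neg)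
  moreover have "- w y \<in> R" if "y \<in> R" for y
    using weyl_root[OF assms(1) base_subset that] by (rule uminus_root)
  ultimately show ?thesis
    using assms(2-4) by (rule pos_if_simple_pos)
qed

text \<open>
  Reading a word from the right, the image of \<open>a\<close> becomes negative at some letter \<open>x\<close>; there it was
  \<open>x\<close> itself, because \<open>reflection x\<close> makes no other positive root negative.  Deleting this letter
  amounts to multiplying by \<open>reflection a\<close>.
\<close>

lemma exchange:
  assumes "set xs \<subseteq> D" "a \<in> D" "- refl_word xs a \<in> pos"
  shows "\<exists>ys. set ys \<subseteq> set xs \<and> Suc (length ys) = length xs \<and>
           refl_word xs \<circ> reflection a = refl_word ys"
  using assms
proof (induction xs)
  case Nil
  then show ?case using base_pos uminus_pos by auto
next
  case (Cons x xs)
  let ?w = "refl_word xs"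
  have w: "?w \<in> weyl D"
    using Cons.prems(1) by (auto simp: weyl_def)
  have "?w a \<in> R"
    using w Cons.prems(2) base_subset weyl_root by blast
  then consider "- ?w a \<in> pos" | "?w a \<in> pos"
    using root_cases by blast
  then show ?case
  proof cases
    case 1
    moreover have "set xs \<subseteq> D"
      using Cons.prems(1) by simp
    ultimately obtain ys where ys: "set ys \<subseteq> set xs" "Suc (length ys) = length xs"
        "?w \<circ> reflection a = refl_word ys"
      using Cons.IH Cons.prems(2) by blast
    have "refl_word (x # xs) \<circ> reflection a = refl_word (x # ys)"
      by (simp only: refl_word_simps o_assoc[symmetric] ys(3))
    moreover have "set (x # ys) \<subseteq> set (x # xs)" "Suc (length (x # ys)) = length (x # xs)"
      using ys(1,2) by auto
    ultimately show ?thesis by blast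
  next
    case 2
    have "reflection x (?w a) \<notin> pos"
      using Cons.prems(3) uminus_pos by fastforce
    then have "?w a = x"
      using simple_reflection_pos[of x "?w a"] 2 Cons.prems(1) by auto
    then have "?w \<circ> reflection a = reflection x \<circ> ?w"
      using weyl_reflection_conjugate[OF w, of a] by (simp only:)
    then have "refl_word (x # xs) \<circ> reflection a = (reflection x \<circ> reflection x) \<circ> ?w"
      by (simp only: refl_word_simps o_assoc[symmetric])
    then have "refl_word (x # xs) \<circ> reflection a = ?w"
      by (simp only: reflection_o_reflection id_o)
    moreover have "set xs \<subseteq> set (x # xs)" "Suc (length xs) = length (x # xs)"
      by auto
    ultimately show ?thesis by blast
  qed
qed

text \<open>
  A shortest word for \<open>w\<close> cannot have a last letter \<open>a\<close>: as \<open>w\<close> keeps \<open>a\<close> positive, the word without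
  this letter makes \<open>a\<close> negative, and the exchange of \<open>a\<close> would give a shorter word for \<open>w\<close>.
\<close>

lemma weyl_eq_id:
  assumes "w \<in> weyl S" "S \<subseteq> D" "\<And>a. a \<in> S \<Longrightarrow> w a \<in> pos"
  shows "w = id"
proof -
  define P where "P k \<longleftrightarrow> (\<exists>xs. set xs \<subseteq> S \<and> length xs = k \<and> w = refl_word xs)" for k
  have "\<exists>k. P k"
    using assms(1) by (auto simp: P_def weyl_def)
  define k where "k = (LEAST k. P k)"
  obtain xs where xs: "set xs \<subseteq> S" "length xs = k" "w = refl_word xs"
    using LeastI_ex[OF \<open>\<exists>k. P k\<close>] unfolding k_def P_def by blast
  have least: "k \<le> l" if "P l" for l
    using that unfolding k_def by (rule Least_le)
  show ?thesis
  proof (cases xs rule: rev_cases)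
    case (snoc ys a)
    have a: "a \<in> S" and ys: "set ys \<subseteq> S"
      using xs(1) snoc by auto
    have w: "w = refl_word ys \<circ> reflection a"
      by (simp only: xs(3) snoc refl_word_snoc)
    have "refl_word ys \<in> weyl S"
      using ys by (auto simp: weyl_def)
    then have "- refl_word ys a \<in> pos"
      using assms(3)[OF a] by (simp add: w reflection_self weyl_uminus)
    then obtain zs where zs: "set zs \<subseteq> set ys" "Suc (length zs) = length ys"
        "refl_word ys \<circ> reflection a = refl_word zs"
      using exchange[of ys a] a ys assms(2) by blast
    then have "P (length zs)"
      unfolding P_def using w ys by auto
    then show ?thesis
      using least[of "length zs"] zs(2) xs(2) snoc by simp
  qed (simp add: xs(3))
qed

text \<open>
  Apart from \<open>a\<close> itself, \<open>reflection a\<close> permutes the positive roots; the root \<open>a\<close> is the one inversion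
  gained.
\<close>

lemma inv_set_comp_reflection_pos:
  assumes "w \<in> weyl D" "a \<in> D" "w a \<in> pos"
  shows "inv_set (w \<circ> reflection a) = insert a (reflection a ` inv_set w)"
proof (intro equalityI subsetI)
  fix x assume "x \<in> inv_set (w \<circ> reflection a)"
  then have x: "x \<in> pos" "- w (reflection a x) \<in> pos"
    by (auto simp: inversions_def neg_iff)
  show "x \<in> insert a (reflection a ` inv_set w)"
  proof (cases "x = a")
    case False
    then have "reflection a x \<in> inv_set w"
      using x simple_reflection_pos[OF assms(2)] by (simp add: inversions_def neg_iff)
    then show ?thesis
      by (metis reflection_reflection imageI insertI2)
  qed simp
next
  fix x assume "x \<in> insert a (reflection a ` inv_set w)"
  then show "x \<in> inv_set (w \<circ> reflection a)"
  proof
    assume "x = a"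
    then show ?thesis
      using assms base_pos
      by (simp add: inversions_def neg_iff reflection_self weyl_uminus[OF assms(1)])
  next
    assume "x \<in> reflection a ` inv_set w"
    then obtain y where y: "x = reflection a y" "y \<in> pos" "- w y \<in> pos"
      by (auto simp: inversions_def neg_iff)
    then have "y \<noteq> a"
      using uminus_pos assms(3) by blast
    then show ?thesis
      using y simple_reflection_pos[OF assms(2)]
      by (simp add: inversions_def neg_iff reflection_reflection)
  qed
qed

lemma card_inv_set_comp_reflection_pos:
  assumes "w \<in> weyl D" "a \<in> D" "w a \<in> pos"
  shows "card (inv_set (w \<circ> reflection a)) = Suc (card (inv_set w))"
proof -
  have "a \<notin> reflection a ` inv_set w"
  proof
    assume "a \<in> reflection a ` inv_set w"
    then obtain y where "y \<in> pos" "a = reflection a y"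
      by (auto simp: inversions_def)
    then have "y = - a"
      by (metis reflection_reflection reflection_self)
    with \<open>y \<in> pos\<close> show False
      using base_pos[OF assms(2)] uminus_pos by blast
  qed
  moreover have "inj_on (reflection a) (inv_set w)"
    by (metis inj_on_inverseI reflection_reflection)
  ultimately show ?thesis
    by (simp add: inv_set_comp_reflection_pos[OF assms] finite_inv_set card_image)
qed

lemma card_inv_set_comp_reflection_neg:
  assumes "w \<in> weyl D" "a \<in> D" "- w a \<in> pos"
  shows "Suc (card (inv_set (w \<circ> reflection a))) = card (inv_set w)"
proof -
  have "w \<circ> reflection a \<in> weyl D"
    using assms by (intro weyl_comp weyl_reflection)
  moreover have "(w \<circ> reflection a) a \<in> pos"
    using assms by (simp add: reflection_self weyl_uminus)
  moreover have "w \<circ> reflection a \<circ> reflection a = w"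
    by (simp add: fun_eq_iff reflection_reflection)
  ultimately show ?thesis
    using card_inv_set_comp_reflection_pos[of "w \<circ> reflection a" a] assms(2) by simp
qed

lemma weyl_simple_cases:
  assumes "w \<in> weyl D" "a \<in> D"
  obtains "w a \<in> pos" | "- w a \<in> pos"
  using assms base_subset weyl_root root_cases by blast

lemma card_inv_set_le_length: "set xs \<subseteq> D \<Longrightarrow> card (inv_set (refl_word xs)) \<le> length xs"
proof (induction xs rule: rev_induct)
  case Nil
  have "inv_set id = {}"
    using uminus_pos by (auto simp: inversions_def)
  then show ?case by (simp only: refl_word_simps card.empty)
next
  case (snoc a xs)
  let ?w = "refl_word xs"
  have w: "?w \<in> weyl D" and a: "a \<in> D"
    using snoc.prems by (auto simp: weyl_def)
  have "card (inv_set (?w \<circ> reflection a)) \<le> Suc (card (inv_set ?w))"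
    using w a
  proof (cases rule: weyl_simple_cases)
    case 1
    then show ?thesis using card_inv_set_comp_reflection_pos[OF w a] by simp
  next
    case 2
    then show ?thesis using card_inv_set_comp_reflection_neg[OF w a] by simp
  qed
  also have "\<dots> \<le> Suc (length xs)"
    using snoc by simp
  finally show ?case
    by (simp only: refl_word_snoc length_append_singleton)
qed

text \<open>
  An element other than the identity makes some simple root negative, and multiplying by the
  reflection in it removes one inversion.
\<close>

lemma word_of_card_inv_set:
  "w \<in> weyl D \<Longrightarrow> \<exists>xs. set xs \<subseteq> D \<and> length xs = card (inv_set w) \<and> w = refl_word xs"
proof (induction "card (inv_set w)" arbitrary: w)
  case 0
  then have empty: "inv_set w = {}"
    using finite_inv_set by simp
  have "w a \<in> pos" if "a \<in> D" for a
  proof (rule weyl_simple_cases[OF 0(2) that])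
    assume "- w a \<in> pos"
    then have "a \<in> inv_set w"
      using base_pos[OF that] by (simp add: inversions_def neg_iff)
    with empty show ?thesis by simp
  qed
  then have "w = id"
    using weyl_eq_id[OF 0(2)] by blast
  then have "set [] \<subseteq> D \<and> length [] = card (inv_set w) \<and> w = refl_word []"
    using 0(1) by (simp only: refl_word_simps list.size) simp
  then show ?case by blast
next
  case (Suc k)
  obtain a where a: "a \<in> D" "- w a \<in> pos"
  proof (rule ccontr)
    assume "\<not> thesis"
    then have "w = id"
      using that Suc.prems weyl_simple_cases by (intro weyl_eq_id[of w D]) blast+
    then have "inv_set w = {}"
      using uminus_pos by (auto simp: inversions_def)
    with Suc.hyps(2) show False by simp
  qed
  have "w \<circ> reflection a \<in> weyl D"
    using Suc.prems a(1) by (intro weyl_comp weyl_reflection)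
  moreover have card: "Suc (card (inv_set (w \<circ> reflection a))) = card (inv_set w)"
    using card_inv_set_comp_reflection_neg[OF Suc.prems a] .
  ultimately obtain xs where xs: "set xs \<subseteq> D" "length xs = card (inv_set (w \<circ> reflection a))"
      "w \<circ> reflection a = refl_word xs"
    using Suc.hyps by (metis Suc_inject)
  have "w = w \<circ> reflection a \<circ> reflection a"
    by (simp add: fun_eq_iff reflection_reflection)
  also have "\<dots> = refl_word (xs @ [a])"
    by (simp only: xs(3) refl_word_snoc)
  finally show ?case
    using xs a(1) card by (intro exI[of _ "xs @ [a]"]) simp
qed

lemma weyl_length_eq_card_inv_set:
  assumes "w \<in> weyl D"
  shows "weyl_length D w = card (inv_set w)"
  unfolding weyl_length_def
proof (rule Least_equality)
  show "\<exists>xs. set xs \<subseteq> D \<and> length xs = card (inv_set w) \<and> w = refl_word xs"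
    using word_of_card_inv_set[OF assms] .
next
  fix k assume "\<exists>xs. set xs \<subseteq> D \<and> length xs = k \<and> w = refl_word xs"
  then show "card (inv_set w) \<le> k"
    using card_inv_set_le_length by blast
qed

section \<open>Coset representatives and longest elements\<close>

lemma weyl_length_comp_reflection_less:
  assumes "w \<in> weyl D" "a \<in> D" "- w a \<in> pos"
  shows "weyl_length D (w \<circ> reflection a) < weyl_length D w"
  using card_inv_set_comp_reflection_neg[OF assms] assms
  by (simp add: weyl_length_eq_card_inv_set weyl_comp weyl_reflection)

lemma weyl_length_comp_reflection_greater:
  assumes "w \<in> weyl D" "a \<in> D" "w a \<in> pos"
  shows "weyl_length D w < weyl_length D (w \<circ> reflection a)"
  using card_inv_set_comp_reflection_pos[OF assms] assms
  by (simp add: weyl_length_eq_card_inv_set weyl_comp weyl_reflection)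

lemma weyl_in_weyl_base: "S \<subseteq> D \<Longrightarrow> w \<in> weyl S \<Longrightarrow> w \<in> weyl D"
  using weyl_mono by blast

text \<open>
  A simple root of \<open>T\<close> made negative by \<open>v\<close> would give a shorter element of the coset.
\<close>

lemma min_reps_pos:
  assumes "v \<in> min_reps D S T" "S \<subseteq> D" "T \<subseteq> D" "x \<in> pos_in T"
  shows "v x \<in> pos"
proof -
  have v: "v \<in> weyl D"
    using assms(1,2) weyl_in_weyl_base by (auto simp: min_reps_def)
  have "v a \<in> pos" if "a \<in> T" for a
    using v
  proof (rule weyl_simple_cases)
    show "a \<in> D" using that assms(3) by blast
    assume "- v a \<in> pos"
    then have "weyl_length D (v \<circ> reflection a) < weyl_length D v"
      using v that assms(3) by (intro weyl_length_comp_reflection_less) auto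
    moreover have "weyl_length D v \<le> weyl_length D (v \<circ> reflection a)"
      using assms(1) weyl_reflection[OF that] by (auto simp: min_reps_def)
    ultimately show ?thesis by simp
  qed
  then show ?thesis
    using weyl_pos_if_simple_pos[OF v assms(3) _ assms(4)] by blast
qed

lemma min_reps_factor:
  assumes "w \<in> weyl S" "T \<subseteq> S"
  shows "\<exists>v u. v \<in> min_reps D S T \<and> u \<in> weyl T \<and> w = v \<circ> u"
proof -
  define k where "k = (LEAST k. \<exists>u\<in>weyl T. weyl_length D (w \<circ> u) = k)"
  have "\<exists>k. \<exists>u\<in>weyl T. weyl_length D (w \<circ> u) = k"
    using weyl_id by blast
  then have "\<exists>u\<in>weyl T. weyl_length D (w \<circ> u) = k"
    unfolding k_def by (rule LeastI_ex)
  then obtain u where u: "u \<in> weyl T" "weyl_length D (w \<circ> u) = k" by blast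
  have least: "k \<le> weyl_length D (w \<circ> u')" if "u' \<in> weyl T" for u'
    unfolding k_def using that by (intro Least_le) blast
  have "w \<circ> u \<in> weyl S"
    using assms u(1) weyl_mono weyl_comp by blast
  moreover have "k \<le> weyl_length D (w \<circ> u \<circ> u')" if "u' \<in> weyl T" for u'
    using least[OF weyl_comp[OF u(1) that]] by (simp only: o_assoc)
  ultimately have "w \<circ> u \<in> min_reps D S T"
    using u(2) by (simp only: min_reps_def mem_Collect_eq) blast
  moreover obtain u' where "u' \<in> weyl T" "u \<circ> u' = id"
    using weyl_inverse[OF u(1)] by blast
  moreover from this have "w = (w \<circ> u) \<circ> u'"
    by (simp only: o_assoc[symmetric] o_id)
  ultimately show ?thesis by blast
qed

lemma min_reps_factor_unique:
  assumes "S \<subseteq> D" "T \<subseteq> S"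
    and v: "v \<in> min_reps D S T" "v' \<in> min_reps D S T"
    and u: "u \<in> weyl T" "u' \<in> weyl T"
    and eq: "v \<circ> u = v' \<circ> u'"
  shows "v = v' \<and> u = u'"
proof -
  have TD: "T \<subseteq> D" using assms by blast
  obtain t where t: "t \<in> weyl T" "t \<circ> u' = id" "u' \<circ> t = id"
    using weyl_inverse[OF u(2)] by blast
  define g where "g = u \<circ> t"
  have g: "g \<in> weyl T"
    unfolding g_def using u(1) t(1) by (rule weyl_comp)
  have "v' = v' \<circ> u' \<circ> t"
    by (simp only: o_assoc[symmetric] t(3) o_id)
  also have "\<dots> = v \<circ> g"
    by (simp only: eq[symmetric] g_def o_assoc)
  finally have v': "v' = v \<circ> g" .
  \<comment> \<open>a simple root of \<open>T\<close> made negative by \<open>g\<close> would remain negative under \<open>v\<close>\<close>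
  have "g a \<in> pos" if a: "a \<in> T" for a
  proof -
    have aT: "a \<in> pos_in T"
      using a TD base_pos by (auto simp: pos_roots_sub_def span_base)
    then have "v (g a) \<in> pos"
      using min_reps_pos[OF v(2) assms(1) TD] by (simp add: v')
    then have no: "- v (g a) \<notin> pos"
      using uminus_pos by blast
    have "- g a \<notin> pos"
    proof
      assume "- g a \<in> pos"
      moreover have "- g a \<in> span T"
        using weyl_in_span_iff[OF g, of T a] a by (simp add: span_neg span_base)
      ultimately have "v (- g a) \<in> pos"
        using min_reps_pos[OF v(1) assms(1) TD] by (simp add: pos_roots_sub_def)
      moreover have "v (- g a) = - v (g a)"
        using v(1) weyl_uminus by (auto simp: min_reps_def)
      ultimately show False
        using no by simp
    qed
    then show ?thesis
      using weyl_simple_cases[OF weyl_in_weyl_base[OF TD g], of a] a TD by blast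
  qed
  then have "g = id"
    using weyl_eq_id[OF g TD] by blast
  then have "v' = v"
    by (simp only: v' o_id)
  moreover have "u = u'"
  proof -
    have "u = u \<circ> (t \<circ> u')"
      by (simp only: t(2) o_id)
    also have "\<dots> = g \<circ> u'"
      by (simp only: g_def o_assoc)
    finally show ?thesis
      using \<open>g = id\<close> by (simp only: id_o)
  qed
  ultimately show ?thesis by simp
qed

text \<open>
  An inversion of \<open>v \<circ> u\<close> outside the span of \<open>T\<close> corresponds, under \<open>u\<close>, to an inversion of \<open>v\<close>,
  and all inversions of \<open>v\<close> arise so, since \<open>v\<close> keeps the positive roots in the span of \<open>T\<close> positive.
\<close>

lemma card_inversions_outside:
  assumes "S \<subseteq> D" "T \<subseteq> S" "v \<in> min_reps D S T" "u \<in> weyl T"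
  shows "card (inv_set (v \<circ> u) \<inter> (pos_in S - pos_in T)) = weyl_length D v"
proof -
  have TD: "T \<subseteq> D" using assms by blast
  have v: "v \<in> weyl S"
    using assms(3) by (simp add: min_reps_def)
  obtain t where t: "t \<in> weyl T" "t \<circ> u = id" "u \<circ> t = id"
    using weyl_inverse[OF assms(4)] by blast
  have tu: "t (u x) = x" "u (t x) = x" for x
    using t by (metis comp_apply id_apply)+
  have outside: "g x \<in> pos_in S - pos_in T" if "g \<in> weyl T" "x \<in> pos_in S - pos_in T" for g x
    using that weyl_pos_outside[OF that(1) TD, of x] weyl_in_span_iff[OF that(1), of T x]
      weyl_in_span_iff[OF that(1) assms(2), of x]
    by (auto simp: pos_roots_sub_def)
  have inv_v: "x \<in> pos_in S - pos_in T" if "x \<in> inv_set v" for x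
  proof -
    have "x \<in> pos_in S"
      using inv_set_subset[OF v assms(1)] that by blast
    moreover have "v x \<notin> pos"
      using that uminus_pos by (auto simp: inversions_def)
    ultimately show ?thesis
      using min_reps_pos[OF assms(3,1) TD] by blast
  qed
  have "bij_betw u (inv_set (v \<circ> u) \<inter> (pos_in S - pos_in T)) (inv_set v)"
  proof (rule bij_betw_byWitness[where f' = t])
    show "u ` (inv_set (v \<circ> u) \<inter> (pos_in S - pos_in T)) \<subseteq> inv_set v"
    proof clarify
      fix x assume x: "x \<in> inv_set (v \<circ> u)" "x \<in> pos_in S" "x \<notin> pos_in T"
      have "u x \<in> pos"
        using outside[OF assms(4)] x by (auto simp: pos_roots_sub_def)
      with x(1) show "u x \<in> inv_set v"
        by (simp add: inversions_def)
    qed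
    show "t ` inv_set v \<subseteq> inv_set (v \<circ> u) \<inter> (pos_in S - pos_in T)"
    proof
      fix y assume "y \<in> t ` inv_set v"
      then obtain x where x: "y = t x" "x \<in> inv_set v" by blast
      have y: "y \<in> pos_in S - pos_in T"
        using outside[OF t(1) inv_v[OF x(2)]] x(1) by simp
      moreover have "y \<in> inv_set (v \<circ> u)"
        using y x(2) by (simp add: inversions_def pos_roots_sub_def x(1) tu)
      ultimately show "y \<in> inv_set (v \<circ> u) \<inter> (pos_in S - pos_in T)" by blast
    qed
  qed (simp_all add: tu)
  then have "card (inv_set (v \<circ> u) \<inter> (pos_in S - pos_in T)) = card (inv_set v)"
    by (rule bij_betw_same_card)
  then show ?thesis
    using weyl_length_eq_card_inv_set weyl_in_weyl_base[OF assms(1) v] by simp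
qed

lemma inversions_inside:
  assumes "S \<subseteq> D" "T \<subseteq> S" "v \<in> min_reps D S T" "u \<in> weyl T"
  shows "inv_set (v \<circ> u) \<inter> pos_in T = inv_set u \<inter> pos_in T"
proof -
  have TD: "T \<subseteq> D" using assms by blast
  have v: "v \<in> weyl S"
    using assms(3) by (simp add: min_reps_def)
  have "- v (u x) \<in> pos \<longleftrightarrow> - u x \<in> pos" if x: "x \<in> pos_in T" for x
  proof -
    have ux: "u x \<in> span T"
      using x weyl_in_span_iff[OF assms(4), of T x] by (simp add: pos_roots_sub_def)
    have "u x \<in> R"
      using x TD base_subset pos_subset
      by (intro weyl_root[OF assms(4)]) (auto simp: pos_roots_sub_def)
    then consider "u x \<in> pos" | "- u x \<in> pos"
      using root_cases by blast
    then show ?thesis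
    proof cases
      case 1
      then have "v (u x) \<in> pos"
        using min_reps_pos[OF assms(3,1) TD] ux by (simp add: pos_roots_sub_def)
      with 1 show ?thesis
        using uminus_pos by blast
    next
      case 2
      then have "v (- u x) \<in> pos"
        using min_reps_pos[OF assms(3,1) TD] ux by (simp add: pos_roots_sub_def span_neg)
      with 2 show ?thesis
        by (simp add: weyl_uminus[OF v])
    qed
  qed
  then show ?thesis
    by (auto simp: inversions_def neg_iff pos_roots_sub_def)
qed

text \<open>
  A simple root kept positive by \<open>w\<close> would give a longer element.
\<close>

lemma max_length_simple_neg:
  assumes "S \<subseteq> D" "w \<in> weyl S" "\<forall>v\<in>weyl S. weyl_length D v \<le> weyl_length D w" "a \<in> S"
  shows "- w a \<in> pos"
  using weyl_in_weyl_base[OF assms(1,2)]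
proof (rule weyl_simple_cases)
  show "a \<in> D" using assms(1,4) by blast
  assume "w a \<in> pos"
  then have "weyl_length D w < weyl_length D (w \<circ> reflection a)"
    using assms weyl_in_weyl_base by (intro weyl_length_comp_reflection_greater) auto
  moreover have "w \<circ> reflection a \<in> weyl S"
    using assms by (intro weyl_comp weyl_reflection)
  ultimately show ?thesis
    using assms(3) by (meson not_less)
qed

lemma longest_ex1:
  assumes "S \<subseteq> D"
  shows "\<exists>!w. w \<in> weyl S \<and> (\<forall>v\<in>weyl S. weyl_length D v \<le> weyl_length D w)"
proof -
  let ?max = "\<lambda>w. w \<in> weyl S \<and> (\<forall>v\<in>weyl S. weyl_length D v \<le> weyl_length D w)"
  have "\<exists>w. ?max w"
  proof -
    have "weyl_length D w < Suc (card pos)" if "w \<in> weyl S" for w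
      using weyl_length_eq_card_inv_set[OF weyl_in_weyl_base[OF assms that]] finite_pos
      by (auto simp: inversions_def less_Suc_eq_le intro!: card_mono)
    then show ?thesis
      using ex_has_greatest_nat[of "\<lambda>w. w \<in> weyl S" id "weyl_length D"] weyl_id
      by (meson less_imp_le)
  qed
  moreover have "w = w'" if max: "?max w" "?max w'" for w w'
  proof -
    have w: "w \<in> weyl S" "w' \<in> weyl S" "w \<in> weyl D" "w' \<in> weyl D"
      using max weyl_in_weyl_base[OF assms] by blast+
    obtain t where t: "t \<in> weyl S" "t \<circ> w = id" "w \<circ> t = id"
      using weyl_inverse[OF w(1)] by blast
    have wt: "w (t x) = x" for x
      using t(3) by (metis comp_apply id_apply)
    \<comment> \<open>\<open>w'\<close> makes \<open>a\<close> negative and \<open>t\<close>, the inverse of \<open>w\<close>, changes the sign once more\<close>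
    have "(t \<circ> w') a \<in> pos" if a: "a \<in> S" for a
    proof -
      let ?b = "t (w' a)"
      have "- w' a \<in> pos"
        using max_length_simple_neg[OF assms] max(2) a by blast
      have "?b \<in> R"
        using weyl_root[OF weyl_in_weyl_base[OF assms t(1)] base_subset]
          weyl_root[OF w(4) base_subset] a assms base_subset by blast
      have "- ?b \<notin> pos"
      proof
        assume "- ?b \<in> pos"
        moreover have "- ?b \<in> span S"
          using a weyl_in_span_iff[OF t(1) subset_refl] weyl_in_span_iff[OF w(2) subset_refl]
          by (simp add: span_neg span_base)
        ultimately have "- ?b \<in> pos_in S"
          by (simp add: pos_roots_sub_def)
        moreover have "- w a \<in> pos" if "a \<in> S" for a
          using max_length_simple_neg[OF assms] max(1) that by blast
        ultimately have "- w (- ?b) \<in> pos"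
          using weyl_neg_if_simple_neg[OF w(3) assms] by blast
        then have "w' a \<in> pos"
          by (simp add: weyl_uminus[OF w(1)] wt)
        with \<open>- w' a \<in> pos\<close> show False
          using uminus_pos by blast
      qed
      with \<open>?b \<in> R\<close> show ?thesis
        using root_cases by auto
    qed
    then have "t \<circ> w' = id"
      using weyl_eq_id[OF weyl_comp[OF t(1) w(2)] assms] by blast
    then have "w \<circ> t \<circ> w' = w"
      by (simp only: o_assoc[symmetric] o_id)
    then show ?thesis
      by (simp only: t(3) id_o)
  qed
  ultimately show "\<exists>!w. ?max w" by blast
qed

lemma longest_in_weyl: "S \<subseteq> D \<Longrightarrow> longest D S \<in> weyl S"
  and longest_max: "S \<subseteq> D \<Longrightarrow> \<forall>v\<in>weyl S. weyl_length D v \<le> weyl_length D (longest D S)"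
  unfolding longest_def using theI'[OF longest_ex1] by blast+

lemma longest_neg:
  assumes "S \<subseteq> D" "x \<in> pos_in S"
  shows "- longest D S x \<in> pos"
  using weyl_in_weyl_base[OF assms(1) longest_in_weyl[OF assms(1)]] assms(1) _ assms(2)
  by (rule weyl_neg_if_simple_neg)
    (use max_length_simple_neg longest_in_weyl longest_max assms(1) in blast)

text \<open>
  The longest element for \<open>T\<close> makes the positive roots in the span of \<open>T\<close> negative and permutes the
  other positive roots in the span of \<open>S\<close>; the longest element for \<open>S\<close> then changes all these signs.
\<close>

lemma inversions_longest_comp_longest:
  assumes "S \<subseteq> D" "T \<subseteq> S"
  shows "inv_set (longest D S \<circ> longest D T) = pos_in S - pos_in T"
proof -
  have TD: "T \<subseteq> D" using assms by blast
  have lS: "longest D S \<in> weyl S" and lT: "longest D T \<in> weyl T" and lTS: "longest D T \<in> weyl S"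
    using longest_in_weyl assms TD weyl_mono by blast+
  have "x \<in> pos_in S - pos_in T \<longleftrightarrow> - longest D S (longest D T x) \<in> pos" if x: "x \<in> pos" for x
  proof -
    consider "x \<in> pos_in T" | "x \<in> pos_in S - pos_in T" | "x \<notin> pos_in S" by blast
    then show ?thesis
    proof cases
      case 1
      then have "- longest D T x \<in> pos"
        using longest_neg[OF TD] by blast
      moreover have "- longest D T x \<in> span S"
        using 1 weyl_in_span_iff[OF lTS, of S x] pos_in_mono[OF assms(2)]
        by (auto simp: pos_roots_sub_def intro: span_neg)
      ultimately have "- longest D S (- longest D T x) \<in> pos"
        using longest_neg[OF assms(1)] by (simp add: pos_roots_sub_def)
      then show ?thesis
        using 1 uminus_pos by (auto simp: weyl_uminus[OF lS])
    next
      case 2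
      then have "longest D T x \<in> pos"
        using weyl_pos_outside[OF lT TD x] x by (simp add: pos_roots_sub_def)
      moreover have "longest D T x \<in> span S"
        using 2 weyl_in_span_iff[OF lTS, of S x] by (simp add: pos_roots_sub_def)
      ultimately show ?thesis
        using 2 longest_neg[OF assms(1)] by (simp add: pos_roots_sub_def)
    next
      case 3
      then have "x \<notin> span S"
        using x by (simp add: pos_roots_sub_def)
      then have "(longest D S \<circ> longest D T) x \<in> pos"
        using weyl_pos_outside[OF weyl_comp[OF lS lTS] assms(1) x] by blast
      then show ?thesis
        using 3 uminus_pos by auto
    qed
  qed
  then show ?thesis
    by (auto simp: inversions_def neg_iff pos_roots_sub_def)
qed

section \<open>Pairings with the coroot lattice\<close>

lemma reflection_coroot_form: "reflection a v = v - (a \<bullet> v) *\<^sub>R coroot a"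
  by (simp add: reflection_def coroot_def inner_commute)

lemma inner_reflection_commute: "x \<bullet> reflection a v = reflection a x \<bullet> v"
  by (metis inner_reflection reflection_reflection)

lemma coroot_lattice_zero: "0 \<in> coroot_lattice S"
  unfolding coroot_lattice_def by (intro CollectI exI[of _ "\<lambda>_. 0"]) simp

lemma coroot_lattice_diff:
  fixes S :: "'a set"
  assumes "l \<in> coroot_lattice S" "l' \<in> coroot_lattice S"
  shows "l - l' \<in> coroot_lattice S"
proof -
  obtain b b' :: "'a \<Rightarrow> int" where "l = (\<Sum>a\<in>S. of_int (b a) *\<^sub>R coroot a)"
      "l' = (\<Sum>a\<in>S. of_int (b' a) *\<^sub>R coroot a)"
    using assms unfolding coroot_lattice_def by blast
  then have "l - l' = (\<Sum>a\<in>S. of_int (b a - b' a) *\<^sub>R coroot a)"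
    by (simp add: sum_subtractf scaleR_diff_left)
  then show ?thesis
    unfolding coroot_lattice_def by (intro CollectI exI[of _ "\<lambda>a. b a - b' a"]) simp
qed

lemma coroot_multiple_in_lattice:
  assumes "finite S" "a \<in> S"
  shows "of_int k *\<^sub>R coroot a \<in> coroot_lattice S"
proof -
  have "(\<Sum>b\<in>S. of_int (if b = a then k else 0) *\<^sub>R coroot b) =
      (\<Sum>b\<in>S. if b = a then of_int k *\<^sub>R coroot a else 0)"
    by (intro sum.cong) auto
  also have "\<dots> = of_int k *\<^sub>R coroot a"
    using assms by simp
  finally show ?thesis
    unfolding coroot_lattice_def
    by (intro CollectI exI[of _ "\<lambda>b. if b = a then k else 0"]) simp
qed

lemma inner_coroot_lattice_Ints:
  assumes "x \<in> R" "S \<subseteq> D" "l \<in> coroot_lattice S"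
  shows "x \<bullet> l \<in> \<int>"
proof -
  obtain b :: "'a \<Rightarrow> int" where "l = (\<Sum>a\<in>S. of_int (b a) *\<^sub>R coroot a)"
    using assms(3) unfolding coroot_lattice_def by blast
  then have "x \<bullet> l = (\<Sum>a\<in>S. of_int (b a) * (x \<bullet> coroot a))"
    by (simp add: inner_sum_right)
  moreover have "x \<bullet> coroot a \<in> \<int>" if "a \<in> S" for a
    using that assms(1,2) base_subset pairing_Ints by blast
  ultimately show ?thesis
    by (simp add: Ints_sum Ints_mult)
qed

lemma coroot_combination_eq_zero:
  assumes "S \<subseteq> D" "(\<Sum>a\<in>S. c a *\<^sub>R coroot a) = 0" "a \<in> S"
  shows "c a = 0"
proof -
  have "(\<Sum>a\<in>S. (c a * (2 / (a \<bullet> a))) *\<^sub>R a) = 0"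
    using assms(2) by (simp add: coroot_def)
  moreover have "finite S"
    using assms(1) finite_base finite_subset by blast
  ultimately have "c a * (2 / (a \<bullet> a)) = 0"
    using independentD[OF independent_base, of S "\<lambda>a. c a * (2 / (a \<bullet> a))" a] assms(1,3) by blast
  moreover have "a \<noteq> 0"
    using assms(1,3) base_subset zero_not_root by blast
  ultimately show ?thesis by simp
qed

text \<open>
  This is the identity \<open>\<langle>2\<rho>, a\<^sup>\<or>\<rangle> = 2\<close> for the half sum \<open>\<rho>\<close> of the positive roots of the parabolic:
  the reflection in \<open>a\<close> permutes the positive roots other than \<open>a\<close> and negates the pairing with
  \<open>coroot a\<close>, so that these roots contribute nothing.
\<close>

lemma sum_pos_in_coroot:
  assumes "S \<subseteq> D" "a \<in> S"
  shows "(\<Sum>x\<in>pos_in S. x \<bullet> coroot a) = 2"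
proof -
  let ?X = "pos_in S - {a}"
  have a: "a \<in> D" "a \<in> pos_in S" "a \<noteq> 0"
    using assms base_pos base_subset zero_not_root by (auto simp: pos_roots_sub_def span_base)
  have closed: "reflection a x \<in> ?X" if x: "x \<in> ?X" for x
  proof -
    have "reflection a x \<in> pos"
      using x simple_reflection_pos[OF a(1)] by (simp add: pos_roots_sub_def)
    moreover have "reflection a x \<in> span S"
      using x weyl_in_span_iff[OF weyl_reflection[OF assms(2)] subset_refl]
      by (simp add: pos_roots_sub_def)
    moreover have "reflection a x \<noteq> a"
    proof
      assume "reflection a x = a"
      then have "x = - a"
        by (metis reflection_reflection reflection_self)
      then show False
        using x uminus_pos[OF base_pos[OF a(1)]] by (simp add: pos_roots_sub_def)
    qed
    ultimately show ?thesis by (simp add: pos_roots_sub_def)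
  qed
  have "(\<Sum>x\<in>?X. x \<bullet> coroot a) = (\<Sum>x\<in>?X. reflection a x \<bullet> coroot a)"
    using closed
    by (intro sum.reindex_bij_witness[of _ "reflection a" "reflection a"])
      (auto simp: reflection_reflection)
  also have "\<dots> = - (\<Sum>x\<in>?X. x \<bullet> coroot a)"
    using a(3) by (simp add: reflection_def inner_diff_left inner_coroot_self flip: sum_negf)
  finally have "(\<Sum>x\<in>?X. x \<bullet> coroot a) = 0" by simp
  then show ?thesis
    using sum.remove[OF finite_pos_in a(2), of "\<lambda>x. x \<bullet> coroot a"] a(3)
    by (simp add: inner_coroot_self)
qed

lemma sum_pos_in_diff_coroot:
  assumes "S \<subseteq> D" "T \<subseteq> S" "a \<in> T"
  shows "(\<Sum>x\<in>pos_in S - pos_in T. x \<bullet> coroot a) = 0"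
  using assms sum_pos_in_coroot[of S a] sum_pos_in_coroot[of T a] pos_in_mono[OF assms(2)]
  by (subst sum_diff[OF finite_pos_in]) auto

text \<open>
  For a positive root \<open>x\<close> that is not simple, some simple root \<open>a\<close> in \<open>S\<close> satisfies \<open>x \<bullet> a > 0\<close>,
  since \<open>x \<bullet> x > 0\<close>.  Reflecting in \<open>a\<close> lowers the height of \<open>x\<close> and changes its coroot by an integer
  multiple of \<open>coroot a\<close>.
\<close>

lemma coroot_in_lattice:
  assumes "S \<subseteq> D" "x \<in> pos_in S"
  shows "coroot x \<in> coroot_lattice S"
  using assms(2)
proof (induction "nat \<lfloor>\<Sum>a\<in>D. coeff x a\<rfloor>" arbitrary: x rule: less_induct)
  case less
  have fin: "finite S"
    using assms(1) finite_base finite_subset by blast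
  have x: "x \<in> pos" "x \<in> span S" "x \<in> R"
    using less.prems pos_subset by (auto simp: pos_roots_sub_def)
  have "\<exists>a\<in>S. a \<bullet> x > 0"
  proof (rule ccontr)
    assume "\<not> ?thesis"
    then have "(\<Sum>a\<in>S. coeff x a * (a \<bullet> x)) \<le> 0"
      using coeff_nonneg[OF x(1)] assms(1) by (intro sum_nonpos mult_nonneg_nonpos) force+
    also have "(\<Sum>a\<in>S. coeff x a * (a \<bullet> x)) = x \<bullet> x"
      by (subst (2) span_expand[OF assms(1) x(2), symmetric]) (simp add: inner_sum_left)
    finally show False
      using x(3) zero_not_root by (metis inner_gt_zero_iff not_less)
  qed
  then obtain a where a: "a \<in> S" "a \<bullet> x > 0" by blast
  have aD: "a \<in> D" "a \<in> R" "a \<noteq> 0"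
    using a(1) assms(1) base_subset zero_not_root by auto
  show ?case
  proof (cases "x = a")
    case True
    then show ?thesis
      using coroot_multiple_in_lattice[OF fin a(1), of 1] by simp
  next
    case False
    let ?y = "reflection a x"
    have y: "?y \<in> pos"
      using simple_reflection_pos[OF aD(1) x(1) False] .
    have "?y \<in> pos_in S"
      using y x(2) weyl_in_span_iff[OF weyl_reflection[OF a(1)] subset_refl]
      by (simp add: pos_roots_sub_def)
    moreover have "nat \<lfloor>\<Sum>b\<in>D. coeff ?y b\<rfloor> < nat \<lfloor>\<Sum>b\<in>D. coeff x b\<rfloor>"
    proof -
      have "(\<Sum>b\<in>D. coeff ?y b) = (\<Sum>b\<in>D. coeff x b) - x \<bullet> coroot a"
      proof -
        have "(\<Sum>b\<in>D. coeff ?y b) =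
            (\<Sum>b\<in>D. coeff x b - (if b = a then x \<bullet> coroot a else 0))"
          by (intro sum.cong)
            (simp_all add: reflection_def coeff_diff coeff_scale coeff_simple[OF aD(1)])
        then show ?thesis
          using finite_base aD(1) by (simp add: sum_subtractf)
      qed
      moreover have "(\<Sum>b\<in>D. coeff ?y b) \<ge> 0"
        using coeff_nonneg[OF y] by (intro sum_nonneg) auto
      moreover have "x \<bullet> coroot a \<ge> 1"
      proof -
        have "x \<bullet> coroot a > 0"
          using a(2) aD(3) by (simp add: coroot_def inner_commute)
        moreover obtain k where "x \<bullet> coroot a = of_int k"
          using pairing_Ints[OF x(3) aD(2)] by (elim Ints_cases)
        ultimately show ?thesis by simp
      qed
      ultimately show ?thesis by linarith
    qed
    ultimately have IH: "coroot ?y \<in> coroot_lattice S"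
      using less.hyps by blast
    obtain k where k: "a \<bullet> coroot x = of_int k"
      using pairing_Ints[OF aD(2) x(3)] by (elim Ints_cases)
    have "coroot ?y = reflection a (coroot x)"
      by (simp add: coroot_def inner_reflection linear_cmul[OF linear_reflection])
    then have "coroot x = coroot ?y - of_int (- k) *\<^sub>R coroot a"
      by (simp add: reflection_coroot_form k)
    then show ?thesis
      using coroot_lattice_diff[OF IH coroot_multiple_in_lattice[OF fin a(1)]] by metis
  qed
qed

section \<open>Representatives pairing to zero or minus one\<close>

text \<open>
  This quadratic form is invariant under the reflections of the parabolic, like the norm.  It is
  preferred to the norm because it takes natural values on vectors that pair integrally with the
  roots, so that it attains a minimum on each coset of the coroot lattice.
\<close>

definition root_form :: "'a set \<Rightarrow> 'a \<Rightarrow> real" where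
  "root_form S v = (\<Sum>x\<in>R \<inter> span S. (x \<bullet> v)\<^sup>2)"

text \<open>
  By invariance, \<open>v\<close> and \<open>coroot y\<close> pair under the form to half of \<open>(y \<bullet> v) * k\<close>, where \<open>k\<close> is the value
  of the form at \<open>coroot y\<close>.
\<close>

lemma root_form_diff_coroot:
  assumes "y \<in> R \<inter> span S"
  shows "\<exists>k>0. \<forall>v. root_form S (v - coroot y) = root_form S v - (y \<bullet> v - 1) * k"
proof -
  let ?\<Phi> = "R \<inter> span S" and ?c = "coroot y"
  have fin: "finite ?\<Phi>"
    using finite_roots by simp
  have y0: "y \<noteq> 0"
    using assms zero_not_root by blast
  have "(y \<bullet> ?c)\<^sup>2 \<le> root_form S ?c"
    unfolding root_form_def using fin assms by (intro member_le_sum) auto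
  then have pos: "root_form S ?c > 0"
    using y0 by (simp add: inner_coroot_self)
  have closed: "reflection y x \<in> ?\<Phi>" if "x \<in> ?\<Phi>" for x
  proof -
    have "reflection y x \<in> R"
      using that reflection_image assms by blast
    moreover have "reflection y x \<in> span S"
      using that assms by (auto simp: reflection_def intro!: span_diff span_scale)
    ultimately show ?thesis by simp
  qed
  have "root_form S (v - ?c) = root_form S v - (y \<bullet> v - 1) * root_form S ?c" for v
  proof -
    define C where "C = (\<Sum>x\<in>?\<Phi>. (x \<bullet> v) * (x \<bullet> ?c))"
    have "C = (\<Sum>x\<in>?\<Phi>. (reflection y x \<bullet> v) * (reflection y x \<bullet> ?c))"
      unfolding C_def using closed
      by (intro sum.reindex_bij_witness[of _ "reflection y" "reflection y"])
        (auto simp: reflection_reflection)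
    also have "\<dots> = (\<Sum>x\<in>?\<Phi>. (y \<bullet> v) * (x \<bullet> ?c)\<^sup>2 - (x \<bullet> v) * (x \<bullet> ?c))"
      using y0
      by (intro sum.cong)
        (simp_all add: reflection_def inner_diff_left inner_coroot_self algebra_simps
          power2_eq_square)
    also have "\<dots> = (y \<bullet> v) * root_form S ?c - C"
      by (simp add: C_def root_form_def sum_subtractf sum_distrib_left)
    finally have C: "2 * C = (y \<bullet> v) * root_form S ?c" by simp
    have "root_form S (v - ?c) = root_form S v - 2 * C + root_form S ?c"
      by (simp add: root_form_def C_def inner_diff_right power2_diff sum.distrib sum_subtractf
          sum_distrib_left algebra_simps)
    then show ?thesis
      unfolding C by (simp add: algebra_simps)
  qed
  with pos show ?thesis by blast
qed

text \<open>
  In the coset of \<open>mu\<close>, an element minimising \<open>root_form S\<close> pairs with every root of the parabolic to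
  \<open>-1\<close>, \<open>0\<close> or \<open>1\<close>, since otherwise translating by a coroot would make the form smaller.  If such an
  element pairs to \<open>1\<close> with a simple root, then reflecting it there keeps it minimal and lowers its
  pairing with \<open>2\<rho>\<close>; among the minimal elements, one with the lowest pairing is therefore
  antidominant.
\<close>

lemma minuscule_representative_exists:
  assumes S: "S \<subseteq> D" and mu: "\<And>x. x \<in> R \<Longrightarrow> x \<bullet> mu \<in> \<int>"
  shows "\<exists>l\<in>coroot_lattice S. \<forall>x\<in>pos_in S. x \<bullet> (mu + l) \<in> {0, - 1}"
proof -
  let ?Q = "coroot_lattice S"
  have fin: "finite S"
    using S finite_base finite_subset by blast
  have int: "of_int \<lfloor>x \<bullet> (mu + l)\<rfloor> = x \<bullet> (mu + l)" if "x \<in> R" "l \<in> ?Q" for x l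
  proof -
    have "x \<bullet> (mu + l) \<in> \<int>"
      using mu[OF that(1)] inner_coroot_lattice_Ints[OF that(1) S that(2)]
      by (simp add: inner_add_right)
    then show ?thesis by (elim Ints_cases) simp
  qed
  \<comment> \<open>\<open>f\<close> is \<open>root_form S\<close> on the coset, and \<open>g\<close> below is the pairing with \<open>2\<rho>\<close> shifted so as to be
    nonnegative; both are natural numbers, which makes the two minima available\<close>
  define f where "f l = (\<Sum>x\<in>R \<inter> span S. nat (\<lfloor>x \<bullet> (mu + l)\<rfloor>\<^sup>2))" for l
  have f: "real (f l) = root_form S (mu + l)" if "l \<in> ?Q" for l
  proof -
    have "real (f l) = (\<Sum>x\<in>R \<inter> span S. (of_int \<lfloor>x \<bullet> (mu + l)\<rfloor>)\<^sup>2)"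
      by (simp add: f_def)
    also have "\<dots> = root_form S (mu + l)"
      unfolding root_form_def
      by (intro sum.cong refl arg_cong[where f = "\<lambda>t. t\<^sup>2"] int that) simp
    finally show ?thesis .
  qed
  obtain l0 where l0: "l0 \<in> ?Q" "\<forall>l. l \<in> ?Q \<longrightarrow> f l0 \<le> f l"
    using ex_has_least_nat[of "\<lambda>l. l \<in> ?Q" 0 f] coroot_lattice_zero by blast
  define A where "A = {l \<in> ?Q. f l = f l0}"
  have le1: "y \<bullet> (mu + l) \<le> 1" if "l \<in> A" "y \<in> pos_in S \<or> - y \<in> pos_in S" for l y
  proof (rule ccontr)
    assume big: "\<not> ?thesis"
    have l: "l \<in> ?Q" "f l = f l0"
      using that(1) by (auto simp: A_def)
    have y: "y \<in> R \<inter> span S"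
      using that(2) pos_subset uminus_root[of "- y"] span_neg[of "- y" S]
      by (auto simp: pos_roots_sub_def)
    have "coroot y \<in> ?Q"
    proof (cases "y \<in> pos_in S")
      case False
      then have "0 - coroot (- y) \<in> ?Q"
        using that(2) by (intro coroot_lattice_diff coroot_lattice_zero coroot_in_lattice[OF S]) auto
      then show ?thesis by (simp add: coroot_def)
    qed (rule coroot_in_lattice[OF S])
    then have l': "l - coroot y \<in> ?Q"
      using l(1) by (rule coroot_lattice_diff[rotated])
    obtain k where k: "k > 0"
        "root_form S (mu + l - coroot y) = root_form S (mu + l) - (y \<bullet> (mu + l) - 1) * k"
      using root_form_diff_coroot[OF y] by blast
    have "(y \<bullet> (mu + l) - 1) * k > 0"
      using big k(1) by simp
    then have "root_form S (mu + (l - coroot y)) < root_form S (mu + l)"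
      using k(2) by (simp add: add_diff_eq)
    then have "f (l - coroot y) < f l"
      using f[OF l'] f[OF l(1)] by linarith
    with l0 l' l(2) show False
      by (metis not_less)
  qed
  have ge1: "y \<bullet> (mu + l) \<ge> - 1" if "l \<in> A" "y \<in> pos_in S" for l y
    using le1[OF that(1), of "- y"] that(2) by simp
  define g where "g l = nat (\<Sum>x\<in>pos_in S. \<lfloor>x \<bullet> (mu + l)\<rfloor> + 1)" for l
  have g: "real (g l) = (\<Sum>x\<in>pos_in S. x \<bullet> (mu + l)) + card (pos_in S)" if "l \<in> A" for l
  proof -
    have "\<lfloor>x \<bullet> (mu + l)\<rfloor> + 1 \<ge> 0" if "x \<in> pos_in S" for x
      using ge1[OF \<open>l \<in> A\<close> that] by linarith
    then have "real (g l) = (\<Sum>x\<in>pos_in S. of_int \<lfloor>x \<bullet> (mu + l)\<rfloor> + 1)"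
      by (simp add: g_def sum_nonneg)
    also have "\<dots> = (\<Sum>x\<in>pos_in S. x \<bullet> (mu + l) + 1)"
      using that pos_subset
      by (intro sum.cong refl arg_cong2[of _ _ _ _ "(+)"] int) (auto simp: A_def pos_roots_sub_def)
    finally show ?thesis by (simp add: sum.distrib)
  qed
  have "l0 \<in> A"
    using l0(1) by (simp add: A_def)
  then obtain l where l: "l \<in> A" "\<forall>l'. l' \<in> A \<longrightarrow> g l \<le> g l'"
    using ex_has_least_nat[of "\<lambda>l. l \<in> A" l0 g] by blast
  have lQ: "l \<in> ?Q"
    using l(1) by (simp add: A_def)
  have simple: "a \<bullet> (mu + l) \<le> 0" if a: "a \<in> S" for a
  proof (rule ccontr)
    assume big: "\<not> ?thesis"
    have aS: "a \<in> pos_in S"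
      using a S base_pos by (auto simp: pos_roots_sub_def span_base)
    then have aR: "a \<in> R" "a \<in> R \<inter> span S"
      using pos_subset by (auto simp: pos_roots_sub_def)
    have one: "a \<bullet> (mu + l) = 1"
    proof -
      obtain k where "a \<bullet> (mu + l) = of_int k"
        using int[OF aR(1) lQ] by metis
      moreover have "a \<bullet> (mu + l) \<le> 1"
        using le1[OF l(1)] aS by blast
      ultimately show ?thesis
        using big by simp
    qed
    have l': "l - coroot a \<in> ?Q"
      using coroot_lattice_diff[OF lQ] coroot_in_lattice[OF S aS] by blast
    have "root_form S (mu + l - coroot a) = root_form S (mu + l)"
      using root_form_diff_coroot[OF aR(2)] one by force
    then have "real (f (l - coroot a)) = real (f l)"
      using f[OF l'] f[OF lQ] by (simp add: add_diff_eq)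
    then have l'A: "l - coroot a \<in> A"
      using l' l(1) by (simp add: A_def)
    have "(\<Sum>x\<in>pos_in S. x \<bullet> (mu + (l - coroot a))) =
        (\<Sum>x\<in>pos_in S. x \<bullet> (mu + l)) - (\<Sum>x\<in>pos_in S. x \<bullet> coroot a)"
      by (simp add: inner_add_right inner_diff_right sum.distrib sum_subtractf algebra_simps)
    then have "real (g (l - coroot a)) = real (g l) - 2"
      using g[OF l'A] g[OF l(1)] sum_pos_in_coroot[OF S a] by simp
    moreover have "g l \<le> g (l - coroot a)"
      using l(2) l'A by blast
    ultimately show False by linarith
  qed
  have "x \<bullet> (mu + l) \<in> {0, - 1}" if x: "x \<in> pos_in S" for x
  proof -
    have xS: "x \<in> pos" "x \<in> span S" "x \<in> R"
      using x pos_subset by (auto simp: pos_roots_sub_def)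
    have "x \<bullet> (mu + l) = (\<Sum>a\<in>D. coeff x a * (a \<bullet> (mu + l)))"
      by (subst coeff_expand[of x, symmetric]) (simp add: inner_sum_left)
    also have "\<dots> \<le> 0"
    proof (rule sum_nonpos)
      fix a assume a: "a \<in> D"
      show "coeff x a * (a \<bullet> (mu + l)) \<le> 0"
        using a xS(2) in_span_iff[OF S] simple coeff_nonneg[OF xS(1) a]
        by (cases "a \<in> S") (auto intro: mult_nonneg_nonpos)
    qed
    finally have "x \<bullet> (mu + l) \<le> 0" .
    moreover have "x \<bullet> (mu + l) \<ge> - 1"
      using ge1[OF l(1) x] .
    moreover obtain k where "x \<bullet> (mu + l) = of_int k"
      using int[OF xS(3) lQ] by metis
    ultimately have "k \<le> 0" "- 1 \<le> k" "x \<bullet> (mu + l) = of_int k"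
      by linarith+
    then show ?thesis
      by (cases "k = 0") auto
  qed
  with lQ show ?thesis by blast
qed

text \<open>
  The difference \<open>d\<close> of two such representatives pairs with all roots of the parabolic to \<open>-1\<close>,
  \<open>0\<close> or \<open>1\<close>.  If it is not zero, then \<open>d \<bullet> d > 0\<close> gives a simple root \<open>a\<close> whose pairing with \<open>d\<close> has the same sign as the
  coefficient of \<open>coroot a\<close> in \<open>d\<close>; reflecting in \<open>a\<close> moves this coefficient by one towards zero.
\<close>

lemma lattice_minuscule_zero:
  assumes S: "S \<subseteq> D"
  shows "\<forall>x\<in>pos_in S. \<bar>x \<bullet> (\<Sum>a\<in>S. of_int (c a) *\<^sub>R coroot a)\<bar> \<le> 1 \<Longrightarrow>
    (\<Sum>a\<in>S. of_int (c a) *\<^sub>R coroot a) = 0"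
proof (induction "\<Sum>a\<in>S. nat \<bar>c a\<bar>" arbitrary: c rule: less_induct)
  case less
  have fin: "finite S"
    using S finite_base finite_subset by blast
  define d where "d = (\<Sum>a\<in>S. of_int (c a) *\<^sub>R coroot a)"
  show ?case
  proof (rule ccontr)
    assume "\<not> ?thesis"
    then have "d \<bullet> d > 0" by (simp add: d_def)
    moreover have "d \<bullet> d = (\<Sum>a\<in>S. of_int (c a) * (coroot a \<bullet> d))"
      by (subst d_def) (simp add: inner_sum_left)
    ultimately obtain a where a: "a \<in> S" "of_int (c a) * (coroot a \<bullet> d) > 0"
      by (metis (no_types, lifting) not_less sum_nonpos)
    have aS: "a \<in> pos_in S"
      using a(1) S base_pos by (auto simp: pos_roots_sub_def span_base)
    then have aR: "a \<in> R" "a \<noteq> 0"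
      using pos_subset zero_not_root by (auto simp: pos_roots_sub_def)
    have same_sign: "of_int (c a) * (a \<bullet> d) > 0"
    proof -
      have "of_int (c a) * (coroot a \<bullet> d) = (2 / (a \<bullet> a)) * (of_int (c a) * (a \<bullet> d))"
        by (simp add: coroot_def)
      moreover have "2 / (a \<bullet> a) > 0"
        using aR(2) by simp
      ultimately show ?thesis
        using a(2) by (metis zero_less_mult_pos)
    qed
    have "d \<in> coroot_lattice S"
      unfolding coroot_lattice_def d_def by blast
    then obtain k where k: "a \<bullet> d = of_int k"
      using inner_coroot_lattice_Ints[OF aR(1) S] by (meson Ints_cases)
    have "\<bar>a \<bullet> d\<bar> \<le> 1"
      using less.prems aS by (simp add: d_def)
    then have "\<bar>k\<bar> \<le> 1" "c a * k > 0"
      using same_sign unfolding k by (metis of_int_1_le_iff of_int_abs of_int_le_1_iff)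
        (metis k of_int_0_less_iff of_int_mult same_sign)
    then have ks: "k = sgn (c a)" "c a \<noteq> 0"
      by (auto simp: zero_less_mult_iff sgn_if)
    define c' where "c' = c(a := c a - sgn (c a))"
    have "(\<Sum>b\<in>S. of_int (c' b) *\<^sub>R coroot b) =
        (\<Sum>b\<in>S. of_int (c b) *\<^sub>R coroot b - (if b = a then of_int k *\<^sub>R coroot a else 0))"
      by (intro sum.cong) (auto simp: c'_def ks scaleR_diff_left)
    also have "\<dots> = d - of_int k *\<^sub>R coroot a"
      using fin a(1) by (simp add: sum_subtractf d_def)
    also have "\<dots> = reflection a d"
      by (simp add: reflection_coroot_form k)
    finally have d': "(\<Sum>b\<in>S. of_int (c' b) *\<^sub>R coroot b) = reflection a d" .
    have "\<bar>x \<bullet> reflection a d\<bar> \<le> 1" if x: "x \<in> pos_in S" for x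
    proof (cases "x = a")
      case True
      then show ?thesis
        using less.prems aS by (simp add: inner_reflection_commute reflection_self d_def)
    next
      case False
      have aD: "a \<in> D" using a(1) S by blast
      have "reflection a x \<in> pos_in S"
        using x False simple_reflection_pos[OF aD, of x]
          weyl_in_span_iff[OF weyl_reflection[OF a(1)] subset_refl]
        by (simp add: pos_roots_sub_def)
      then show ?thesis
        using less.prems by (simp add: inner_reflection_commute d_def)
    qed
    moreover have "(\<Sum>b\<in>S. nat \<bar>c' b\<bar>) < (\<Sum>b\<in>S. nat \<bar>c b\<bar>)"
    proof (rule sum_strict_mono_ex1[OF fin])
      show "\<forall>b\<in>S. nat \<bar>c' b\<bar> \<le> nat \<bar>c b\<bar>"
        by (auto simp: c'_def sgn_if)
      show "\<exists>b\<in>S. nat \<bar>c' b\<bar> < nat \<bar>c b\<bar>"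
        using a(1) ks(2) by (intro bexI[of _ a]) (auto simp: c'_def sgn_if)
    qed
    ultimately have "reflection a d = 0"
      using less.hyps[of c'] by (simp add: d')
    then have "d = 0"
      by (metis reflection_reflection linear_0[OF linear_reflection])
    with \<open>d \<bullet> d > 0\<close> show False by simp
  qed
qed

end

section \<open>The grading on the Weyl group\<close>

locale numbered_root_system = based_root_system R "\<alpha> ` {1..n}"
  for R :: "'a::euclidean_space set" and \<alpha> :: "nat \<Rightarrow> 'a" and n :: nat +
  fixes r :: nat
  assumes inj: "inj_on \<alpha> {1..n}" and r_ge: "1 \<le> r" and r_less: "r < n"
begin

\<comment> \<open>keeps the index set \<open>{1..n}\<close> from being rewritten to \<open>{Suc 0..n}\<close>, which would hide the base\<close>
declare One_nat_def [simp del]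

abbreviation base_set :: "'a set" where
  "base_set \<equiv> \<alpha> ` {1..n}"

abbreviation lev :: "nat \<Rightarrow> 'a set" where
  "lev j \<equiv> level \<alpha> n r j"

abbreviation lev_roots :: "nat \<Rightarrow> 'a set" where
  "lev_roots i \<equiv> level_roots R \<alpha> n r i"

lemma level_subset: "lev j \<subseteq> base_set"
  using r_less by (auto simp: level_def)

lemma level_mono: "i \<le> j \<Longrightarrow> lev i \<subseteq> lev j"
  using r_less by (auto simp: level_def)

lemma level_0: "lev 0 = {}"
  by (simp add: level_def)

lemma level_top: "lev (r + 1) = base_set"
  by (simp add: level_def)

lemma level_roots_eq: "lev_roots i = pos_in (lev i) - pos_in (lev (i - 1))"
  by (simp add: level_roots_def)

definition level_product :: "(nat \<Rightarrow> 'a \<Rightarrow> 'a) \<Rightarrow> nat \<Rightarrow> 'a \<Rightarrow> 'a" where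
  "level_product v m = fold (\<lambda>j u. v j \<circ> u) [1..<Suc m] id"

lemma level_product_0: "level_product v 0 = id"
  by (simp add: level_product_def)

lemma level_product_Suc: "level_product v (Suc m) = v (Suc m) \<circ> level_product v m"
  by (simp add: level_product_def)

definition level_factors :: "(nat \<Rightarrow> 'a \<Rightarrow> 'a) \<Rightarrow> nat \<Rightarrow> bool" where
  "level_factors v m \<longleftrightarrow> (\<forall>j\<in>{1..m}. v j \<in> min_reps base_set (lev j) (lev (j - 1)))"

lemma level_factors_Suc:
  "level_factors v (Suc m) \<longleftrightarrow>
     level_factors v m \<and> v (Suc m) \<in> min_reps base_set (lev (Suc m)) (lev m)"
  by (auto simp: level_factors_def atLeastAtMostSuc_conv)

lemma level_product_cong: "(\<And>j. j \<in> {1..m} \<Longrightarrow> v j = v' j) \<Longrightarrow> level_product v m = level_product v' m"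
proof (induction m)
  case (Suc m)
  have "level_product v m = level_product v' m"
    using Suc by simp
  moreover have "v (Suc m) = v' (Suc m)"
    using Suc.prems by simp
  ultimately show ?case
    by (simp only: level_product_Suc)
qed (simp only: level_product_0)

lemma level_product_in_weyl: "level_factors v m \<Longrightarrow> level_product v m \<in> weyl (lev m)"
proof (induction m)
  case 0
  show ?case by (simp only: level_product_0 weyl_id)
next
  case (Suc m)
  then have "v (Suc m) \<in> weyl (lev (Suc m))"
    by (auto simp: level_factors_Suc min_reps_def)
  moreover have "level_product v m \<in> weyl (lev (Suc m))"
    using Suc weyl_mono[OF level_mono[of m "Suc m"]] by (auto simp: level_factors_Suc)
  ultimately show ?case
    unfolding level_product_Suc by (rule weyl_comp)
qed

lemma level_factors_exist:
  "w \<in> weyl (lev m) \<Longrightarrow>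
     \<exists>v. level_factors v m \<and> (\<forall>j. j \<notin> {1..m} \<longrightarrow> v j = id) \<and> w = level_product v m"
proof (induction m arbitrary: w)
  case 0
  then have "w = id"
    using weyl_empty by (simp add: level_0)
  then have "level_factors (\<lambda>_. id) 0 \<and> (\<forall>j. j \<notin> {1..0} \<longrightarrow> id = id) \<and>
      w = level_product (\<lambda>_. id) 0"
    by (simp add: level_factors_def level_product_0)
  then show ?case by blast
next
  case (Suc m)
  obtain x u where xu: "x \<in> min_reps base_set (lev (Suc m)) (lev m)" "u \<in> weyl (lev m)"
      "w = x \<circ> u"
    using min_reps_factor[OF Suc.prems level_mono[of m "Suc m"]] by auto
  obtain v where v: "level_factors v m" "\<forall>j. j \<notin> {1..m} \<longrightarrow> v j = id" "u = level_product v m"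
    using Suc.IH[OF xu(2)] by blast
  define v' where "v' = v(Suc m := x)"
  have "level_factors v' m"
    using v(1) by (auto simp: level_factors_def v'_def)
  then have "level_factors v' (Suc m)"
    using xu(1) by (simp add: level_factors_Suc v'_def)
  moreover have "\<forall>j. j \<notin> {1..Suc m} \<longrightarrow> v' j = id"
    using v(2) by (auto simp: v'_def)
  moreover have "level_product v' m = level_product v m"
    by (rule level_product_cong) (simp add: v'_def)
  then have "w = level_product v' (Suc m)"
    unfolding level_product_Suc xu(3) v(3) by (simp add: v'_def)
  ultimately show ?case by blast
qed

lemma level_factors_unique:
  assumes "level_factors v m" "level_factors v' m" "level_product v m = level_product v' m"
    and "j \<in> {1..m}"
  shows "v j = v' j"
  using assms
proof (induction m)
  case (Suc m)
  have v: "v (Suc m) \<in> min_reps base_set (lev (Suc m)) (lev m)" "level_factors v m"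
    and v': "v' (Suc m) \<in> min_reps base_set (lev (Suc m)) (lev m)" "level_factors v' m"
    using Suc.prems(1,2) by (simp_all add: level_factors_Suc)
  have "v (Suc m) \<circ> level_product v m = v' (Suc m) \<circ> level_product v' m"
    using Suc.prems(3) by (simp only: level_product_Suc)
  then have "v (Suc m) = v' (Suc m) \<and> level_product v m = level_product v' m"
    by (rule min_reps_factor_unique[OF level_subset level_mono[OF le_SucI[OF order_refl]]
          v(1) v'(1) level_product_in_weyl[OF v(2)] level_product_in_weyl[OF v'(2)]])
  with Suc.IH[OF v(2) v'(2)] Suc.prems(4) show ?case
    by (cases "j = Suc m") auto
qed simp

text \<open>
  The factors above \<open>i\<close> do not change signs on level \<open>i\<close>, and the factors below \<open>i\<close> permute the
  positive roots of level \<open>i\<close> that are not of level \<open>i - 1\<close>.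
\<close>

lemma card_inversions_level_product:
  "level_factors v m \<Longrightarrow> i \<in> {1..m} \<Longrightarrow>
     card (inv_set (level_product v m) \<inter> lev_roots i) = weyl_length base_set (v i)"
proof (induction m)
  case (Suc m)
  have v: "v (Suc m) \<in> min_reps base_set (lev (Suc m)) (lev m)"
    and u: "level_product v m \<in> weyl (lev m)"
    using Suc.prems(1) level_product_in_weyl by (auto simp: level_factors_Suc)
  have sub: "lev (Suc m) \<subseteq> base_set" "lev m \<subseteq> lev (Suc m)"
    by (simp_all add: level_subset level_mono)
  show ?case
  proof (cases "i = Suc m")
    case True
    show ?thesis
      using card_inversions_outside[OF sub v u]
      by (simp only: True level_product_Suc level_roots_eq diff_Suc_1)
  next
    case False
    then have i: "i \<in> {1..m}"
      using Suc.prems(2) by simp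
    then have "lev_roots i \<subseteq> pos_in (lev m)"
      using pos_in_mono[OF level_mono[of i m]] by (auto simp: level_roots_eq)
    then have "inv_set (level_product v (Suc m)) \<inter> lev_roots i =
        inv_set (level_product v m) \<inter> lev_roots i"
      using inversions_inside[OF sub v u] unfolding level_product_Suc by blast
    moreover have "level_factors v m"
      using Suc.prems(1) by (simp add: level_factors_Suc)
    ultimately show ?thesis
      using Suc.IH i by simp
  qed
qed simp

text \<open>
  The decomposition exists and is unique, so the definite description in \<open>decomp\<close> denotes it.
\<close>

lemma weyl_length_decomp:
  assumes "w \<in> weyl base_set" "i \<in> {1..r + 1}"
  shows "weyl_length base_set (decomp \<alpha> n r w i) = card (inv_set w \<inter> lev_roots i)"
proof -
  let ?P = "\<lambda>v. level_factors v (r + 1) \<and> (\<forall>j. j \<notin> {1..r + 1} \<longrightarrow> v j = id) \<and>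
    w = level_product v (r + 1)"
  have "\<exists>v. ?P v"
    using level_factors_exist[of w "r + 1"] assms(1) by (simp add: level_top)
  moreover have "v = v'" if "?P v" "?P v'" for v v'
  proof
    fix j
    show "v j = v' j"
      using that level_factors_unique[of v "r + 1" v' j] by (cases "j \<in> {1..r + 1}") auto
  qed
  ultimately have "\<exists>!v. ?P v" by blast
  then have "?P (THE v. ?P v)"
    by (rule theI')
  moreover have "decomp \<alpha> n r w = (THE v. ?P v)"
  proof -
    have "r + 2 = Suc (r + 1)" by simp
    then show ?thesis
      by (simp only: decomp_def level_factors_def level_product_def)
  qed
  ultimately have "level_factors (decomp \<alpha> n r w) (r + 1)"
      "w = level_product (decomp \<alpha> n r w) (r + 1)"
    by simp_all
  then show ?thesis
    using card_inversions_level_product[OF _ assms(2)] by metis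
qed

lemma sum_unit_vec: "(\<Sum>i=1..N. f i * unit_vec i m) = (if m \<in> {1..N} then f m else 0)"
proof -
  have "(\<Sum>i=1..N. f i * unit_vec i m) = (\<Sum>i=1..N. if i = m then f m else 0)"
    by (intro sum.cong) (auto simp: unit_vec_def)
  then show ?thesis by simp
qed

lemma gr'_weyl_eq:
  assumes "w \<in> weyl base_set"
  shows "gr'_weyl \<alpha> n r w m =
    (if m \<in> {1..r + 1} then int (card (inv_set w \<inter> lev_roots m)) else 0)"
  unfolding gr'_weyl_def sum_unit_vec using weyl_length_decomp[OF assms, of m] by simp

section \<open>The grading on the coroot lattice\<close>

lemma level_le: "j \<le> r \<Longrightarrow> lev j = \<alpha> ` {1..j}"
  by (simp add: level_def)

lemma inj_on_initial: "j \<le> r \<Longrightarrow> inj_on \<alpha> {1..j}"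
  using inj r_less by (auto intro: inj_on_subset)

lemma numbered_coroot_combination_zero:
  fixes c :: "nat \<Rightarrow> real"
  assumes "j \<le> n" "(\<Sum>i=1..j. c i *\<^sub>R coroot (\<alpha> i)) = 0" "i \<in> {1..j}"
  shows "c i = 0"
proof -
  let ?inv = "the_inv_into {1..j} \<alpha>"
  have inj_j: "inj_on \<alpha> {1..j}"
    using inj assms(1) by (auto intro: inj_on_subset)
  have "(\<Sum>a\<in>\<alpha> ` {1..j}. c (?inv a) *\<^sub>R coroot a) = (\<Sum>i=1..j. c i *\<^sub>R coroot (\<alpha> i))"
    by (simp add: sum.reindex[OF inj_j] the_inv_into_f_f[OF inj_j])
  then have "c (?inv (\<alpha> i)) = 0"
    using assms by (intro coroot_combination_eq_zero[of "\<alpha> ` {1..j}" "\<lambda>a. c (?inv a)"]) auto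
  then show ?thesis
    using assms(3) by (simp add: the_inv_into_f_f[OF inj_j])
qed

definition lift_condition :: "nat \<Rightarrow> nat \<Rightarrow> (nat \<Rightarrow> int) \<Rightarrow> bool" where
  "lift_condition k j a \<longleftrightarrow>
     (\<forall>i. i \<notin> {1..j} \<longrightarrow> a i = 0) \<and>
     (\<forall>\<gamma>\<in>pos_in (lev j).
        \<gamma> \<bullet> (coroot (\<alpha> k) + (\<Sum>i=1..j. of_int (a i) *\<^sub>R coroot (\<alpha> i))) \<in> {0, - 1})"

text \<open>
  Two lifts in the same coset differ by a lattice element whose pairings with the roots of level \<open>j\<close>
  are differences of values in \<open>{0, - 1}\<close>, hence at most \<open>1\<close> in absolute value.
\<close>

lemma lift_condition_ex1:
  assumes "j \<le> r" "k \<in> {1..n}"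
  shows "\<exists>!a. lift_condition k j a"
proof -
  have inj_j: "inj_on \<alpha> {1..j}"
    using inj_on_initial[OF assms(1)] .
  have lev: "lev j = \<alpha> ` {1..j}"
    using level_le[OF assms(1)] .
  have "\<alpha> k \<in> R"
    using assms(2) base_subset by blast
  then obtain l where l: "l \<in> coroot_lattice (lev j)"
      "\<forall>x\<in>pos_in (lev j). x \<bullet> (coroot (\<alpha> k) + l) \<in> {0, - 1}"
    using minuscule_representative_exists[OF level_subset, of "coroot (\<alpha> k)"] pairing_Ints
    by blast
  obtain b :: "'a \<Rightarrow> int" where b: "l = (\<Sum>a\<in>lev j. of_int (b a) *\<^sub>R coroot a)"
    using l(1) unfolding coroot_lattice_def by blast
  have "lift_condition k j (\<lambda>i. if i \<in> {1..j} then b (\<alpha> i) else 0)"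
  proof -
    have "l = (\<Sum>i=1..j. of_int (if i \<in> {1..j} then b (\<alpha> i) else 0) *\<^sub>R coroot (\<alpha> i))"
      unfolding b lev by (simp add: sum.reindex[OF inj_j])
    with l(2) show ?thesis
      unfolding lift_condition_def by simp
  qed
  moreover have "a = a'" if a: "lift_condition k j a" "lift_condition k j a'" for a a'
  proof
    fix i
    define c where "c x = a (the_inv_into {1..j} \<alpha> x) - a' (the_inv_into {1..j} \<alpha> x)" for x
    let ?d = "\<Sum>i=1..j. of_int (a i - a' i) *\<^sub>R coroot (\<alpha> i)"
    have d: "(\<Sum>x\<in>lev j. of_int (c x) *\<^sub>R coroot x) = ?d"
      unfolding lev by (simp add: sum.reindex[OF inj_j] c_def the_inv_into_f_f[OF inj_j])
    have "\<bar>x \<bullet> ?d\<bar> \<le> 1" if "x \<in> pos_in (lev j)" for x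
    proof -
      have "x \<bullet> ?d = x \<bullet> (coroot (\<alpha> k) + (\<Sum>i=1..j. of_int (a i) *\<^sub>R coroot (\<alpha> i)))
          - x \<bullet> (coroot (\<alpha> k) + (\<Sum>i=1..j. of_int (a' i) *\<^sub>R coroot (\<alpha> i)))"
        by (simp add: scaleR_diff_left sum_subtractf inner_diff_right inner_add_right)
      moreover have "x \<bullet> (coroot (\<alpha> k) + (\<Sum>i=1..j. of_int (a i) *\<^sub>R coroot (\<alpha> i))) \<in> {0, - 1}"
        and "x \<bullet> (coroot (\<alpha> k) + (\<Sum>i=1..j. of_int (a' i) *\<^sub>R coroot (\<alpha> i))) \<in> {0, - 1}"
        using a that unfolding lift_condition_def by blast+
      ultimately show ?thesis by auto
    qed
    then have "?d = 0"
      using lattice_minuscule_zero[OF level_subset, of j c] unfolding d by blast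
    then show "a i = a' i"
      using numbered_coroot_combination_zero[of j "\<lambda>i. of_int (a i - a' i)" i] a assms(1) r_less
      by (cases "i \<in> {1..j}") (auto simp: lift_condition_def)
  qed
  ultimately show ?thesis by blast
qed

context
  fixes k j
  assumes j: "j \<le> r" and k: "k \<in> {1..n}"
begin

abbreviation (input) "lift_a \<equiv> lift_coeffs R \<alpha> n r k j"
abbreviation (input) "lift_l \<equiv> lift_elt R \<alpha> n r k j"
abbreviation (input) "lift_u \<equiv> lift_weyl R \<alpha> n r k j"

lemma lift_elt_pairing: "x \<in> pos_in (lev j) \<Longrightarrow> x \<bullet> lift_l \<in> {0, - 1}"
proof -
  have "lift_a = (THE a. lift_condition k j a)"
    by (simp add: lift_coeffs_def lift_condition_def)
  then have "lift_condition k j lift_a"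
    using theI'[OF lift_condition_ex1[OF j k]] by simp
  then show "x \<in> pos_in (lev j) \<Longrightarrow> x \<bullet> lift_l \<in> {0, - 1}"
    by (simp add: lift_condition_def lift_elt_def)
qed

lemma lift_weyl_in_weyl: "lift_u \<in> weyl base_set"
proof -
  have longest: "longest base_set S \<in> weyl base_set" if "S \<subseteq> base_set" for S
    using weyl_in_weyl_base[OF that longest_in_weyl[OF that]] .
  have "{\<beta>\<in>lev j. \<beta> \<bullet> lift_l = 0} \<subseteq> base_set"
    using level_subset by blast
  from weyl_comp[OF longest[OF level_subset] longest[OF this]] show ?thesis
    by (simp only: lift_weyl_def Let_def)
qed

text \<open>
  All simple roots of level \<open>j\<close> pair nonpositively with \<open>lift_l\<close>.  A positive root of this level is
  thus orthogonal to it precisely when it is a combination of simple roots orthogonal to it.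
\<close>

lemma inversions_lift_weyl: "inv_set lift_u = {x \<in> pos_in (lev j). x \<bullet> lift_l = - 1}"
proof -
  let ?T = "{\<beta>\<in>lev j. \<beta> \<bullet> lift_l = 0}"
  have simple: "a \<bullet> lift_l \<le> 0" if "a \<in> lev j" for a
  proof -
    have "a \<in> pos_in (lev j)"
      using that level_subset base_pos by (auto simp: pos_roots_sub_def span_base)
    then show ?thesis
      using lift_elt_pairing by fastforce
  qed
  have T: "?T \<subseteq> base_set"
    using level_subset by blast
  have "x \<in> pos_in ?T \<longleftrightarrow> x \<bullet> lift_l = 0" if x: "x \<in> pos_in (lev j)" for x
  proof -
    have xS: "x \<in> pos" "x \<in> span (lev j)"
      using x by (auto simp: pos_roots_sub_def)
    have sum: "x \<bullet> lift_l = (\<Sum>a\<in>base_set. coeff x a * (a \<bullet> lift_l))"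
      by (subst coeff_expand[of x, symmetric]) (simp only: inner_sum_left inner_scaleR_left)
    have terms: "coeff x a * (a \<bullet> lift_l) \<le> 0" if "a \<in> base_set" for a
      using that xS in_span_iff[OF level_subset] simple coeff_nonneg[OF xS(1) that]
      by (cases "a \<in> lev j") (auto intro: mult_nonneg_nonpos)
    have "x \<bullet> lift_l = 0 \<longleftrightarrow> (\<forall>a\<in>base_set. coeff x a * (a \<bullet> lift_l) = 0)"
      using sum_nonneg_eq_0_iff[OF finite_base, of "\<lambda>a. - (coeff x a * (a \<bullet> lift_l))"] terms
      by (simp add: sum sum_negf)
    also have "\<dots> \<longleftrightarrow> (\<forall>a\<in>base_set - ?T. coeff x a = 0)"
      using xS(2) in_span_iff[OF level_subset] by auto
    also have "\<dots> \<longleftrightarrow> x \<in> span ?T"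
      using in_span_iff[OF T] by simp
    finally show ?thesis
      using xS(1) by (simp add: pos_roots_sub_def)
  qed
  moreover have "inv_set lift_u = pos_in (lev j) - pos_in ?T"
    unfolding lift_weyl_def Let_def
    by (rule inversions_longest_comp_longest[OF level_subset]) blast
  ultimately show ?thesis
    using lift_elt_pairing by auto
qed

lemma pairing_lift_elt:
  "x \<in> pos_in (lev j) \<Longrightarrow> x \<bullet> lift_l = - (if x \<in> inv_set lift_u then 1 else 0)"
  using lift_elt_pairing by (auto simp: inversions_lift_weyl)

lemma sum_pairing_lift_elt:
  assumes "X \<subseteq> pos_in (lev j)"
  shows "(\<Sum>x\<in>X. x \<bullet> lift_l) = - real (card (inv_set lift_u \<inter> X))"
proof -
  have "finite X"
    using assms finite_pos_in by (rule finite_subset)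
  have "(\<Sum>x\<in>X. x \<bullet> lift_l) = - (\<Sum>x\<in>X. if x \<in> inv_set lift_u then 1 else 0)"
    using assms pairing_lift_elt by (simp add: subset_iff sum_negf[symmetric] cong: sum.cong)
  also have "(\<Sum>x\<in>X. if x \<in> inv_set lift_u then 1 else 0) = real (card (inv_set lift_u \<inter> X))"
    using \<open>finite X\<close> by (simp add: sum.If_cases Int_commute)
  finally show ?thesis .
qed

lemma sum_lift_elt:
  "(\<Sum>x\<in>X. x \<bullet> lift_l) = (\<Sum>x\<in>X. x \<bullet> coroot (\<alpha> k)) +
     (\<Sum>i=1..j. of_int (lift_a i) * (\<Sum>x\<in>X. x \<bullet> coroot (\<alpha> i)))"
proof -
  have "(\<Sum>x\<in>X. x \<bullet> lift_l) = (\<Sum>x\<in>X. x \<bullet> coroot (\<alpha> k)) +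
      (\<Sum>x\<in>X. \<Sum>i=1..j. of_int (lift_a i) * (x \<bullet> coroot (\<alpha> i)))"
    by (simp add: lift_elt_def inner_add_right inner_sum_right sum.distrib)
  also have "(\<Sum>x\<in>X. \<Sum>i=1..j. of_int (lift_a i) * (x \<bullet> coroot (\<alpha> i))) =
      (\<Sum>i=1..j. of_int (lift_a i) * (\<Sum>x\<in>X. x \<bullet> coroot (\<alpha> i)))"
    by (subst sum.swap) (simp add: sum_distrib_left)
  finally show ?thesis .
qed

text \<open>
  Up to level \<open>j\<close> the pairings with \<open>lift_l\<close> cancel the inversions of \<open>lift_u\<close>; above level
  \<open>j + 1\<close> both contributions vanish; and at level \<open>j + 1\<close> the pairing is that with
  \<open>2\<rho>\<close> of level \<open>j + 1\<close> minus that with \<open>2\<rho>\<close> of level \<open>j\<close>.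
\<close>

lemma level_sum_lift_elt:
  assumes ak: "\<alpha> k \<in> lev (j + 1)" and m: "m \<in> {1..r + 1}"
  shows "(\<Sum>x\<in>lev_roots m. x \<bullet> lift_l) =
    of_int ((int (weyl_length base_set lift_u) + 2 + (\<Sum>i=1..j. 2 * lift_a i)) *
      unit_vec (j + 1) m) - of_int (gr'_weyl \<alpha> n r lift_u m)"
proof -
  have inv: "inv_set lift_u \<subseteq> pos_in (lev j)"
    by (auto simp: inversions_lift_weyl)
  have gr': "gr'_weyl \<alpha> n r lift_u m = int (card (inv_set lift_u \<inter> lev_roots m))"
    using gr'_weyl_eq[OF lift_weyl_in_weyl, of m] m by simp
  have len: "weyl_length base_set lift_u = card (inv_set lift_u)"
    using weyl_length_eq_card_inv_set[OF lift_weyl_in_weyl] .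
  have ai: "\<alpha> i \<in> lev j" if "i \<in> {1..j}" for i
    using that level_le[OF j] by simp
  consider "m \<le> j" | "m = j + 1" | "m > j + 1" by linarith
  then show ?thesis
  proof cases
    case 1
    then have "lev_roots m \<subseteq> pos_in (lev j)"
      using pos_in_mono[OF level_mono[OF 1]] by (auto simp: level_roots_eq)
    from sum_pairing_lift_elt[OF this] 1 show ?thesis
      by (simp add: gr' unit_vec_def)
  next
    case 2
    have sub: "lev j \<subseteq> lev (j + 1)"
      by (rule level_mono) simp
    have two: "(\<Sum>x\<in>pos_in (lev (j + 1)). x \<bullet> lift_l) = 2 + (\<Sum>i=1..j. of_int (lift_a i) * 2)"
    proof -
      have "(\<Sum>x\<in>pos_in (lev (j + 1)). x \<bullet> coroot (\<alpha> i)) = 2" if "i \<in> {1..j}" for i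
        using sum_pos_in_coroot[OF level_subset] ai[OF that] sub by blast
      moreover have "(\<Sum>x\<in>pos_in (lev (j + 1)). x \<bullet> coroot (\<alpha> k)) = 2"
        using sum_pos_in_coroot[OF level_subset ak] .
      ultimately show ?thesis
        by (simp add: sum_lift_elt)
    qed
    have "(\<Sum>x\<in>lev_roots m. x \<bullet> lift_l) =
        (\<Sum>x\<in>pos_in (lev (j + 1)). x \<bullet> lift_l) - (\<Sum>x\<in>pos_in (lev j). x \<bullet> lift_l)"
      using sum_diff[OF finite_pos_in pos_in_mono[OF sub]] by (simp add: level_roots_eq 2)
    also have "(\<Sum>x\<in>pos_in (lev j). x \<bullet> lift_l) = - real (card (inv_set lift_u))"
      using sum_pairing_lift_elt[of "pos_in (lev j)"] inv by (simp add: Int_absorb2)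
    finally have "(\<Sum>x\<in>lev_roots m. x \<bullet> lift_l) =
        2 + (\<Sum>i=1..j. of_int (lift_a i) * 2) + real (card (inv_set lift_u))"
      unfolding two by simp
    moreover have "inv_set lift_u \<inter> lev_roots m = {}"
      using inv by (auto simp: level_roots_eq 2)
    ultimately show ?thesis
      by (simp add: gr'[unfolded 2] len unit_vec_def 2 mult.commute)
  next
    case 3
    have sub: "lev (j + 1) \<subseteq> lev (m - 1)" "lev j \<subseteq> lev (m - 1)" "lev (m - 1) \<subseteq> lev m"
      using 3 by (auto intro!: level_mono)
    have zero: "(\<Sum>x\<in>lev_roots m. x \<bullet> coroot a) = 0" if "a \<in> lev (m - 1)" for a
      unfolding level_roots_eq using sum_pos_in_diff_coroot[OF level_subset sub(3) that] .
    have "(\<Sum>x\<in>lev_roots m. x \<bullet> lift_l) = 0"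
      unfolding sum_lift_elt using zero ak ai sub by (simp add: subset_iff)
    moreover have "inv_set lift_u \<inter> lev_roots m = {}"
      using inv pos_in_mono[OF sub(2)] by (auto simp: level_roots_eq)
    ultimately show ?thesis
      using 3 by (simp add: gr' unit_vec_def)
  qed
qed

end

text \<open>
  For \<open>k = 1\<close> the sum is the pairing of \<open>coroot (\<alpha> 1)\<close> with \<open>2\<rho>\<close> of level \<open>1\<close>, or with a difference of
  such sums at two levels that both contain \<open>\<alpha> 1\<close>.  For larger \<open>k\<close>, solving the formula for the lifted
  element for the term of \<open>\<alpha> k\<close> gives the recursion that defines \<open>gr'_coroot\<close>.
\<close>

lemma gr'_coroot_eq:
  "k \<in> {1..n} \<Longrightarrow> of_int (gr'_coroot R \<alpha> n r k m) =
     (if m \<in> {1..r + 1} then \<Sum>x\<in>lev_roots m. x \<bullet> coroot (\<alpha> k) else 0)"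
proof (induction k rule: less_induct)
  case (less k)
  show ?case
  proof (cases "k = 1")
    case True
    have a1: "\<alpha> 1 \<in> lev i" if "1 \<le> i" for i
      using that r_ge r_less by (auto simp: level_def)
    have "(\<Sum>x\<in>lev_roots m. x \<bullet> coroot (\<alpha> 1)) = 2" if "m = 1"
      using sum_pos_in_coroot[OF level_subset a1[of 1]]
      by (simp add: that level_roots_eq level_0 pos_in_empty)
    moreover have "(\<Sum>x\<in>lev_roots m. x \<bullet> coroot (\<alpha> 1)) = 0" if "m > 1"
      unfolding level_roots_eq
      using that by (intro sum_pos_in_diff_coroot level_subset level_mono a1) auto
    ultimately show ?thesis
      using r_ge by (subst gr'_coroot.simps) (auto simp: True unit_vec_def)
  next
    case False
    define j where "j = min (k - 1) r"
    define a where "a = lift_coeffs R \<alpha> n r k j"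
    define u where "u = lift_weyl R \<alpha> n r k j"
    have j: "j \<le> r" "j < k" "j \<le> n"
      using less.prems False r_less by (auto simp: j_def)
    have ak: "\<alpha> k \<in> lev (j + 1)"
      using less.prems False by (auto simp: j_def level_def min_def)
    have IH: "of_int (gr'_coroot R \<alpha> n r i m) =
        (if m \<in> {1..r + 1} then \<Sum>x\<in>lev_roots m. x \<bullet> coroot (\<alpha> i) else 0)" if "i \<in> {1..j}" for i
      using that j by (intro less.IH) auto
    have rec: "gr'_coroot R \<alpha> n r k m =
        (int (weyl_length base_set u) + 2 + (\<Sum>i=1..j. 2 * a i)) * unit_vec (j + 1) m
          - gr'_weyl \<alpha> n r u m - (\<Sum>i=1..j. a i * gr'_coroot R \<alpha> n r i m)"
      using less.prems False
      by (subst gr'_coroot.simps) (simp add: Let_def j_def a_def u_def)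
    show ?thesis
    proof (cases "m \<in> {1..r + 1}")
      case True
      have "of_int (\<Sum>i=1..j. a i * gr'_coroot R \<alpha> n r i m) =
          (\<Sum>i=1..j. of_int (a i) * (\<Sum>x\<in>lev_roots m. x \<bullet> coroot (\<alpha> i)))"
        unfolding of_int_sum of_int_mult using IH True by (intro sum.cong) auto
      then show ?thesis
        using level_sum_lift_elt[OF j(1) less.prems ak True] True
          sum_lift_elt[OF j(1) less.prems, of "lev_roots m"]
        unfolding rec a_def u_def by simp
    next
      case m: False
      have "gr'_coroot R \<alpha> n r i m = 0" if "i \<in> {1..j}" for i
        using IH[OF that] m by (simp split: if_splits)
      moreover have "gr'_weyl \<alpha> n r u m = 0"
        using m gr'_weyl_eq[OF lift_weyl_in_weyl[OF j(1) less.prems], of m] by (auto simp: u_def)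
      moreover have "unit_vec (j + 1) m = 0"
        using m j(1) by (auto simp: unit_vec_def)
      ultimately show ?thesis
        unfolding rec if_not_P[OF m] by simp
    qed
  qed
qed

theorem gr_eq_gr':
  assumes w: "w \<in> weyl base_set" and l: "l \<in> coroot_lattice base_set"
  shows "gr R \<alpha> n r w l = gr' R \<alpha> n r w l"
proof
  fix m
  obtain c :: "'a \<Rightarrow> int" where "l = (\<Sum>a\<in>base_set. of_int (c a) *\<^sub>R coroot a)"
    using l unfolding coroot_lattice_def by blast
  then have l_eq: "l = (\<Sum>k=1..n. of_int (c (\<alpha> k)) *\<^sub>R coroot (\<alpha> k))"
    by (simp add: sum.reindex[OF inj])
  let ?b = "\<lambda>k. if k \<in> {1..n} then c (\<alpha> k) else 0"
  have b: "coroot_coeffs \<alpha> n l = ?b"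
    unfolding coroot_coeffs_def
  proof (rule the_equality)
    show "(\<forall>k. k \<notin> {1..n} \<longrightarrow> ?b k = 0) \<and> l = (\<Sum>k=1..n. of_int (?b k) *\<^sub>R coroot (\<alpha> k))"
      by (simp add: l_eq)
  next
    fix b'
    assume b': "(\<forall>k. k \<notin> {1..n} \<longrightarrow> b' k = 0) \<and> l = (\<Sum>k=1..n. of_int (b' k) *\<^sub>R coroot (\<alpha> k))"
    then have "(\<Sum>k=1..n. of_int (b' k - c (\<alpha> k)) *\<^sub>R coroot (\<alpha> k)) = 0"
      using l_eq by (simp add: scaleR_diff_left sum_subtractf)
    then have "b' k = c (\<alpha> k)" if "k \<in> {1..n}" for k
      using numbered_coroot_combination_zero[of n "\<lambda>k. of_int (b' k - c (\<alpha> k))" k] that by simp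
    with b' show "b' = ?b" by auto
  qed
  have linear: "of_int (\<Sum>k=1..n. coroot_coeffs \<alpha> n l k * gr'_coroot R \<alpha> n r k m) =
      (if m \<in> {1..r + 1} then \<Sum>x\<in>lev_roots m. x \<bullet> l else 0)"
  proof -
    have "of_int (\<Sum>k=1..n. coroot_coeffs \<alpha> n l k * gr'_coroot R \<alpha> n r k m) =
        (\<Sum>k=1..n. of_int (c (\<alpha> k)) *
          (if m \<in> {1..r + 1} then \<Sum>x\<in>lev_roots m. x \<bullet> coroot (\<alpha> k) else 0))"
      unfolding of_int_sum of_int_mult b by (intro sum.cong) (simp_all add: gr'_coroot_eq)
    also have "\<dots> = (if m \<in> {1..r + 1} then
        \<Sum>k=1..n. \<Sum>x\<in>lev_roots m. of_int (c (\<alpha> k)) * (x \<bullet> coroot (\<alpha> k)) else 0)"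
      by (cases "m \<in> {1..r + 1}") (simp_all add: sum_distrib_left del: atLeastAtMost_iff)
    also have "(\<Sum>k=1..n. \<Sum>x\<in>lev_roots m. of_int (c (\<alpha> k)) * (x \<bullet> coroot (\<alpha> k))) =
        (\<Sum>x\<in>lev_roots m. x \<bullet> l)"
      by (subst sum.swap) (simp add: l_eq inner_sum_right)
    finally show ?thesis .
  qed
  have floors: "of_int (\<Sum>x\<in>lev_roots m. \<lfloor>x \<bullet> l\<rfloor>) = (\<Sum>x\<in>lev_roots m. x \<bullet> l)"
  proof -
    have "of_int \<lfloor>x \<bullet> l\<rfloor> = x \<bullet> l" if "x \<in> lev_roots m" for x
    proof -
      have "x \<in> R"
        using that pos_subset by (auto simp: level_roots_eq pos_roots_sub_def)
      from inner_coroot_lattice_Ints[OF this subset_refl l] show ?thesis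
        by (elim Ints_cases) simp
    qed
    then show ?thesis
      unfolding of_int_sum by (rule sum.cong[OF refl])
  qed
  have gr: "gr R \<alpha> n r w l m = (if m \<in> {1..r + 1} then
      int (card (inv_set w \<inter> lev_roots m)) + (\<Sum>x\<in>lev_roots m. \<lfloor>x \<bullet> l\<rfloor>) else 0)"
    unfolding gr_def by (rule sum_unit_vec)
  have "real_of_int (gr R \<alpha> n r w l m) = real_of_int (gr' R \<alpha> n r w l m)"
    unfolding gr gr'_def gr'_weyl_eq[OF w] of_int_add linear
    using floors by (simp split: if_split)
  then show "gr R \<alpha> n r w l m = gr' R \<alpha> n r w l m"
    by simp
qed

end

theorem theorem2p8:
  fixes R \<Delta> \<Delta>P :: "'a::euclidean_space set" and \<alpha> :: "nat \<Rightarrow> 'a" and n r :: nat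
  assumes "root_system R" and "irreducible_roots R" and "root_base R \<Delta>"
    and "\<Delta>P \<noteq> {}" and "\<Delta>P \<subset> \<Delta>"
    and "dynkin_connected \<Delta>P" and "\<forall>m. \<not> of_type \<Delta>P (TypeA m)"
    and "bij_betw \<alpha> {1..n} \<Delta>" and "bij_betw \<alpha> {1..r} \<Delta>P"
    and "listed_ordering \<alpha> n r"
  shows "\<forall>w\<in>weyl \<Delta>. \<forall>l\<in>coroot_lattice \<Delta>. gr R \<alpha> n r w l = gr' R \<alpha> n r w l"
proof -
  have \<Delta>: "\<Delta> = \<alpha> ` {1..n}" and inj: "inj_on \<alpha> {1..n}"
    using assms(8) by (auto simp: bij_betw_def)
  have "r < n"
  proof -
    have "finite \<Delta>"
      by (simp add: \<Delta>)
    then have "card \<Delta>P < card \<Delta>"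
      using assms(5) by (rule psubset_card_mono)
    then show ?thesis
      using bij_betw_same_card[OF assms(8)] bij_betw_same_card[OF assms(9)] by simp
  qed
  moreover have "1 \<le> r"
    using assms(4,9) by (cases r) (auto simp: bij_betw_def)
  ultimately interpret numbered_root_system R \<alpha> n r
    using assms(1,3) inj by unfold_locales (simp_all add: \<Delta>)
  show ?thesis
    using gr_eq_gr' by (simp add: \<Delta>)
qed

end
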